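(* Every cyclic subgroup of a bireversible group is undistorted.
   Context: Distortion. Let $G$ be a group generated by a finite set $S$ and $H\leq G$ a subgroup generated by a finite set $T\subseteq H$. $H$ is undistorted in $G$ if there is a constant $C\in\mathbb{R}_{>0}$ such that $|h|_T\leq C|h|_S$ for all $h\in H$, where $|\cdot|_T$ and $|\cdot|_S$ are the word metrics in $H$ with respect to $T$ and in $G$ with respect to $S$ (this is independent of the choice of $S$ and $T$). Bireversible groups. A Mealy automaton is a tuple $\mathcal{M}=(A,Q,\lambda,\rho)$ where $A$ (alphabet) and $Q$ (state set) are finite sets and $\lambda\colon Q\times A\to A$, $\rho\colon Q\times A\to Q$ are maps. It is invertible if $\lambda_q\colon A\to A$, $a\mapsto\lambda(q,a)$ is a bijection for every $q\in Q$; reversible if $\rho_a\colon Q\to Q$, $q\mapsto \rho(q,a)$ is a bijection for every $a\in A$; bireversible if it is invertible, reversible and $Q\times A\to A\times Q$, $(q,a)\mapsto(\lambda(q,a),\rho(q,a))$ is a bijection. Let $A^*$ be the free monoid on $A$. Each $\lambda_q$ extends to $A^*$ by $\lambda_q(aw)=\lambda_q(a)\lambda_{\rho(q,a)}(w)$. If $\mathcal{M}$ is invertible, these are bijections of $A^*$, giving a homomorphism $f_Q$ from the free group $F_Q$ to the group of bijections of $A^*$ (acting on the left), and the group generated by $\mathcal{M}$ is $G_{\mathcal{M}}=F_Q/\ker(f_Q)$. A group is called bireversible if it is isomorphic to $G_{\mathcal{M}}$ for some bireversible automaton $\mathcal{M}$. *)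

theory Defs
  imports "HOL-Algebra.Algebra"
begin

section \<open>Word lengths and distortion\<close>

text \<open>Only meaningful when \<open>g\<close> lies in the subgroup generated by \<open>S\<close>; otherwise the
  \<open>LEAST\<close> is unspecified.\<close>

definition word_length :: "('g, 'm) monoid_scheme \<Rightarrow> 'g set \<Rightarrow> 'g \<Rightarrow> nat" where
  "word_length G S g =
     (LEAST n. \<exists>ws. length ws = n \<and> set ws \<subseteq> S \<union> m_inv G ` S
                   \<and> foldr (\<lambda>x y. x \<otimes>\<^bsub>G\<^esub> y) ws \<one>\<^bsub>G\<^esub> = g)"

definition finite_generating_set :: "('g, 'm) monoid_scheme \<Rightarrow> 'g set \<Rightarrow> bool" where
  "finite_generating_set G S \<longleftrightarrow>
     finite S \<and> S \<subseteq> carrier G \<and> generate G S = carrier G"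

text \<open>The notion does not depend on the choice of finite generating sets. Requiring the
  linear bound for all of them, and the existence of at least one for each group, is therefore
  the same as requiring it for some fixed choice, but leaves nothing vacuous.\<close>

definition undistorted :: "('g, 'm) monoid_scheme \<Rightarrow> 'g set \<Rightarrow> bool" where
  "undistorted G H \<longleftrightarrow>
     (\<exists>S. finite_generating_set G S) \<and>
     (\<exists>T. finite_generating_set (G\<lparr>carrier := H\<rparr>) T) \<and>
     (\<forall>S T. finite_generating_set G S \<and> finite_generating_set (G\<lparr>carrier := H\<rparr>) T \<longrightarrow>
        (\<exists>C::real. C > 0 \<and>
          (\<forall>h\<in>H. real (word_length (G\<lparr>carrier := H\<rparr>) T h) \<le> C * real (word_length G S h))))"


section \<open>Free groups\<close>

text \<open>Elements are freely reduced words; the letter \<open>(q, True)\<close> stands for the generator \<open>q\<close>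
  and \<open>(q, False)\<close> for its inverse.\<close>

definition inv_letter :: "'q \<times> bool \<Rightarrow> 'q \<times> bool" where
  "inv_letter x = (fst x, \<not> snd x)"

definition freely_reduced :: "('q \<times> bool) list \<Rightarrow> bool" where
  "freely_reduced w \<longleftrightarrow> successively (\<lambda>x y. y \<noteq> inv_letter x) w"

fun push_letter :: "'q \<times> bool \<Rightarrow> ('q \<times> bool) list \<Rightarrow> ('q \<times> bool) list" where
  "push_letter x [] = [x]"
| "push_letter x (y # w) = (if y = inv_letter x then w else x # y # w)"

text \<open>For reduced \<open>u\<close> and \<open>v\<close>, \<open>foldr push_letter u v\<close> is the free reduction of \<open>u @ v\<close>.\<close>

definition free_group :: "'q set \<Rightarrow> ('q \<times> bool) list monoid" where
  "free_group Q =
     \<lparr>carrier = {w \<in> lists (Q \<times> UNIV). freely_reduced w},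
      monoid.mult = \<lambda>u v. foldr push_letter u v,
      one = []\<rparr>"

lemma inv_letter_inv_letter [simp]: "inv_letter (inv_letter x) = x"
  by (simp add: inv_letter_def)

lemma inv_letter_neq [simp]: "inv_letter x \<noteq> x"
  by (cases x) (auto simp: inv_letter_def)

lemma inv_letter_in [simp]: "inv_letter x \<in> Q \<times> UNIV \<longleftrightarrow> x \<in> Q \<times> UNIV"
  by (cases x) (auto simp: inv_letter_def)

lemma freely_reduced_Nil [simp]: "freely_reduced []"
  by (simp add: freely_reduced_def)

lemma freely_reduced_Cons:
  "freely_reduced (x # w) \<longleftrightarrow> freely_reduced w \<and> (w = [] \<or> hd w \<noteq> inv_letter x)"
  by (cases w) (auto simp: freely_reduced_def)

lemma freely_reduced_push: "freely_reduced w \<Longrightarrow> freely_reduced (push_letter x w)"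
  by (cases w) (auto simp: freely_reduced_Cons)

lemma freely_reduced_foldr_push: "freely_reduced w \<Longrightarrow> freely_reduced (foldr push_letter u w)"
  by (induction u) (auto simp: freely_reduced_push)

lemma push_letter_in_lists:
  "x \<in> Q \<times> UNIV \<Longrightarrow> w \<in> lists (Q \<times> UNIV) \<Longrightarrow> push_letter x w \<in> lists (Q \<times> UNIV)"
  by (cases w) auto

lemma foldr_push_in_lists:
  "u \<in> lists (Q \<times> UNIV) \<Longrightarrow> w \<in> lists (Q \<times> UNIV)
     \<Longrightarrow> foldr push_letter u w \<in> lists (Q \<times> UNIV)"
  by (induction u) (simp_all add: push_letter_in_lists)

lemma push_push_inv: "freely_reduced w \<Longrightarrow> push_letter x (push_letter (inv_letter x) w) = w"
  by (cases w; cases "tl w") (auto simp: freely_reduced_Cons)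

lemma foldr_push_push:
  "freely_reduced w
     \<Longrightarrow> foldr push_letter (push_letter x u) w = push_letter x (foldr push_letter u w)"
  by (cases u) (auto simp: push_push_inv freely_reduced_foldr_push)

lemma foldr_push_assoc:
  "freely_reduced w
     \<Longrightarrow> foldr push_letter (foldr push_letter u v) w = foldr push_letter u (foldr push_letter v w)"
  by (induction u) (auto simp: foldr_push_push)

lemma foldr_push_Nil: "freely_reduced u \<Longrightarrow> foldr push_letter u [] = u"
proof (induction u)
  case (Cons x u)
  then show ?case by (cases u) (auto simp: freely_reduced_Cons)
qed simp

lemma foldr_push_inverse:
  "freely_reduced w \<Longrightarrow> foldr push_letter (map inv_letter (rev u)) (foldr push_letter u w) = w"
proof (induction u arbitrary: w)
  case (Cons x u)
  then show ?case
    using push_push_inv[of "foldr push_letter u w" "inv_letter x"]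
    by (simp add: freely_reduced_foldr_push)
qed simp

lemma group_free_group: "group (free_group Q)"
proof (rule groupI)
  fix u assume u: "u \<in> carrier (free_group Q)"
  let ?v = "foldr push_letter (map inv_letter (rev u)) []"
  have "map inv_letter (rev u) \<in> lists (Q \<times> UNIV)"
    using u by (fastforce simp: free_group_def inv_letter_def)
  then have "?v \<in> carrier (free_group Q)"
    by (simp add: free_group_def foldr_push_in_lists freely_reduced_foldr_push)
  moreover have "?v \<otimes>\<^bsub>free_group Q\<^esub> u = \<one>\<^bsub>free_group Q\<^esub>"
  proof -
    have "foldr push_letter ?v u = foldr push_letter (map inv_letter (rev u)) u"
      using u foldr_push_assoc[of u "map inv_letter (rev u)" "[]"] by (simp add: free_group_def)
    also have "\<dots> = foldr push_letter (map inv_letter (rev u)) (foldr push_letter u [])"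
      using u by (simp add: free_group_def foldr_push_Nil)
    finally show ?thesis
      by (simp add: free_group_def foldr_push_inverse)
  qed
  ultimately show "\<exists>v\<in>carrier (free_group Q). v \<otimes>\<^bsub>free_group Q\<^esub> u = \<one>\<^bsub>free_group Q\<^esub>"
    by blast
qed (auto simp: free_group_def foldr_push_in_lists freely_reduced_foldr_push foldr_push_assoc
     simp del: in_lists_conv_set)


section \<open>Mealy automata and the groups they generate\<close>

record ('a, 'q) mealy =
  alphabet :: "'a set"
  states :: "'q set"
  letter_out :: "'q \<times> 'a \<Rightarrow> 'a"
  next_state :: "'q \<times> 'a \<Rightarrow> 'q"

definition mealy_automaton :: "('a, 'q) mealy \<Rightarrow> bool" where
  "mealy_automaton M \<longleftrightarrow>
     finite (alphabet M) \<and> finite (states M) \<and>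
     letter_out M \<in> states M \<times> alphabet M \<rightarrow> alphabet M \<and>
     next_state M \<in> states M \<times> alphabet M \<rightarrow> states M"

definition invertible_automaton :: "('a, 'q) mealy \<Rightarrow> bool" where
  "invertible_automaton M \<longleftrightarrow>
     (\<forall>q\<in>states M. bij_betw (\<lambda>a. letter_out M (q, a)) (alphabet M) (alphabet M))"

definition reversible_automaton :: "('a, 'q) mealy \<Rightarrow> bool" where
  "reversible_automaton M \<longleftrightarrow>
     (\<forall>a\<in>alphabet M. bij_betw (\<lambda>q. next_state M (q, a)) (states M) (states M))"

definition bireversible_automaton :: "('a, 'q) mealy \<Rightarrow> bool" where
  "bireversible_automaton M \<longleftrightarrow>
     mealy_automaton M \<and> invertible_automaton M \<and> reversible_automaton M \<and>
     bij_betw (\<lambda>x. (letter_out M x, next_state M x))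
       (states M \<times> alphabet M) (alphabet M \<times> states M)"

fun transduce :: "('a, 'q) mealy \<Rightarrow> 'q \<Rightarrow> 'a list \<Rightarrow> 'a list" where
  "transduce M q [] = []"
| "transduce M q (a # w) = letter_out M (q, a) # transduce M (next_state M (q, a)) w"

text \<open>\<open>BijGroup\<close> consists of functions that are extensional on the given set, whence the
  restriction to the words over the alphabet.\<close>

definition state_action :: "('a, 'q) mealy \<Rightarrow> 'q \<Rightarrow> 'a list \<Rightarrow> 'a list" where
  "state_action M q = restrict (transduce M q) (lists (alphabet M))"

definition letter_action :: "('a, 'q) mealy \<Rightarrow> 'q \<times> bool \<Rightarrow> 'a list \<Rightarrow> 'a list" where
  "letter_action M x =
     (if snd x then state_action M (fst x)
      else inv\<^bsub>BijGroup (lists (alphabet M))\<^esub> state_action M (fst x))"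

text \<open>The homomorphism \<open>f\<^sub>Q\<close>. Multiplication in \<open>BijGroup\<close> is composition of functions, so
  the rightmost letter acts first.\<close>

definition free_action :: "('a, 'q) mealy \<Rightarrow> ('q \<times> bool) list \<Rightarrow> 'a list \<Rightarrow> 'a list" where
  "free_action M w =
     foldr (\<lambda>x g. letter_action M x \<otimes>\<^bsub>BijGroup (lists (alphabet M))\<^esub> g) w
       \<one>\<^bsub>BijGroup (lists (alphabet M))\<^esub>"

definition automaton_group :: "('a, 'q) mealy \<Rightarrow> ('q \<times> bool) list set monoid" where
  "automaton_group M =
     free_group (states M) Mod
       kernel (free_group (states M)) (BijGroup (lists (alphabet M))) (free_action M)"

text \<open>HOL cannot quantify over types inside a formula, so the types of letters and states of
  the automaton are parameters.\<close>

definition bireversible_group ::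
    "'a itself \<Rightarrow> 'q itself \<Rightarrow> ('g, 'm) monoid_scheme \<Rightarrow> bool" where
  "bireversible_group A Q G \<longleftrightarrow>
     group G \<and> (\<exists>M :: ('a, 'q) mealy. bireversible_automaton M \<and> G \<cong> automaton_group M)"

lemma transduce_in_lists:
  assumes "mealy_automaton M" "q \<in> states M" "w \<in> lists (alphabet M)"
  shows "transduce M q w \<in> lists (alphabet M)"
  using assms(2,3)
proof (induction w arbitrary: q)
  case (Cons a w)
  then have "letter_out M (q, a) \<in> alphabet M" "next_state M (q, a) \<in> states M"
    using assms(1) by (auto simp: mealy_automaton_def Pi_iff)
  with Cons show ?case by auto
qed simp

lemma transduce_inject:
  assumes "mealy_automaton M" "invertible_automaton M" "q \<in> states M"
    "v \<in> lists (alphabet M)" "w \<in> lists (alphabet M)" "transduce M q v = transduce M q w"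
  shows "v = w"
  using assms(3-6)
proof (induction v arbitrary: q w)
  case Nil
  then show ?case by (cases w) auto
next
  case (Cons a v)
  then obtain b w' where w: "w = b # w'" by (cases w) auto
  have "a = b"
    using Cons.prems assms(2) unfolding w
    by (auto simp: invertible_automaton_def bij_betw_def dest: inj_onD)
  moreover have "next_state M (q, a) \<in> states M"
    using Cons.prems assms(1) by (auto simp: mealy_automaton_def Pi_iff)
  ultimately show ?case
    using Cons.prems Cons.IH[of "next_state M (q, a)" w'] unfolding w by auto
qed

lemma transduce_surj:
  assumes "mealy_automaton M" "invertible_automaton M" "q \<in> states M" "w \<in> lists (alphabet M)"
  shows "\<exists>v\<in>lists (alphabet M). transduce M q v = w"
  using assms(3,4)
proof (induction w arbitrary: q)
  case Nil
  show ?case by (rule bexI[of _ "[]"]) auto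
next
  case (Cons b w)
  then have "b \<in> (\<lambda>a. letter_out M (q, a)) ` alphabet M"
    using assms(2) by (auto simp: invertible_automaton_def bij_betw_def)
  then obtain a where a: "a \<in> alphabet M" "letter_out M (q, a) = b" by auto
  then have "next_state M (q, a) \<in> states M"
    using Cons.prems assms(1) by (auto simp: mealy_automaton_def Pi_iff)
  then obtain v where "v \<in> lists (alphabet M)" "transduce M (next_state M (q, a)) v = w"
    using Cons by auto
  with a show ?case by (intro bexI[of _ "a # v"]) auto
qed

lemma state_action_in_BijGroup:
  assumes "mealy_automaton M" "invertible_automaton M" "q \<in> states M"
  shows "state_action M q \<in> carrier (BijGroup (lists (alphabet M)))"
proof -
  have "bij_betw (transduce M q) (lists (alphabet M)) (lists (alphabet M))"
    unfolding bij_betw_def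
  proof
    show "inj_on (transduce M q) (lists (alphabet M))"
      by (rule inj_onI) (rule transduce_inject[OF assms])
    show "transduce M q ` lists (alphabet M) = lists (alphabet M)"
    proof (intro equalityI subsetI)
      fix w assume "w \<in> lists (alphabet M)"
      then obtain v where "v \<in> lists (alphabet M)" "transduce M q v = w"
        using transduce_surj[OF assms] by blast
      then show "w \<in> transduce M q ` lists (alphabet M)" by blast
    qed (use transduce_in_lists[OF assms(1,3)] in blast)
  qed
  then have "bij_betw (restrict (transduce M q) (lists (alphabet M)))
      (lists (alphabet M)) (lists (alphabet M))"
    by (subst bij_betw_restrict_eq)
  then show ?thesis
    by (simp add: BijGroup_def Bij_def state_action_def)
qed

lemma letter_action_in_BijGroup:
  assumes "mealy_automaton M" "invertible_automaton M" "x \<in> states M \<times> UNIV"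
  shows "letter_action M x \<in> carrier (BijGroup (lists (alphabet M)))"
  using assms state_action_in_BijGroup[of M "fst x"] group_BijGroup[of "lists (alphabet M)"]
  by (auto simp: letter_action_def group.inv_closed)

lemma letter_action_inv_letter:
  assumes "mealy_automaton M" "invertible_automaton M" "x \<in> states M \<times> UNIV"
  shows "letter_action M (inv_letter x) = inv\<^bsub>BijGroup (lists (alphabet M))\<^esub> letter_action M x"
  using assms state_action_in_BijGroup[of M "fst x"] group_BijGroup[of "lists (alphabet M)"]
  by (auto simp: letter_action_def inv_letter_def group.inv_inv)

lemma free_action_in_BijGroup:
  assumes "mealy_automaton M" "invertible_automaton M" "w \<in> lists (states M \<times> UNIV)"
  shows "free_action M w \<in> carrier (BijGroup (lists (alphabet M)))"
  using assms(3)
proof (induction w)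
  case Nil
  show ?case
    using group.is_monoid[OF group_BijGroup[of "lists (alphabet M)"]]
    by (simp add: free_action_def monoid.one_closed)
next
  case (Cons x w)
  interpret B: group "BijGroup (lists (alphabet M))" by (rule group_BijGroup)
  show ?case
    using Cons letter_action_in_BijGroup[OF assms(1,2), of x]
    by (simp add: free_action_def del: mem_Times_iff in_lists_conv_set)
qed

lemma free_action_push:
  assumes "mealy_automaton M" "invertible_automaton M"
    and x: "x \<in> states M \<times> UNIV" and w: "w \<in> lists (states M \<times> UNIV)"
  shows "free_action M (push_letter x w) =
    letter_action M x \<otimes>\<^bsub>BijGroup (lists (alphabet M))\<^esub> free_action M w"
proof (cases "\<exists>v. w = inv_letter x # v")
  case True
  then obtain v where v: "w = inv_letter x # v" by blast
  interpret B: group "BijGroup (lists (alphabet M))" by (rule group_BijGroup)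
  have "free_action M v \<in> carrier (BijGroup (lists (alphabet M)))"
    using free_action_in_BijGroup[OF assms(1,2)] w v by simp
  moreover have "letter_action M x \<in> carrier (BijGroup (lists (alphabet M)))"
    by (rule letter_action_in_BijGroup[OF assms(1-3)])
  moreover have "free_action M w =
      letter_action M (inv_letter x) \<otimes>\<^bsub>BijGroup (lists (alphabet M))\<^esub> free_action M v"
    by (simp add: v free_action_def)
  ultimately show ?thesis
    by (simp add: v letter_action_inv_letter[OF assms(1-3)] flip: B.m_assoc)
next
  case False
  then show ?thesis by (cases w) (auto simp: free_action_def)
qed

lemma free_action_hom:
  assumes "mealy_automaton M" "invertible_automaton M"
  shows "group_hom (free_group (states M)) (BijGroup (lists (alphabet M))) (free_action M)"
proof (intro group_hom.intro group_hom_axioms.intro group_free_group group_BijGroup homI)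
  fix u v assume uv: "u \<in> carrier (free_group (states M))" "v \<in> carrier (free_group (states M))"
  interpret B: group "BijGroup (lists (alphabet M))" by (rule group_BijGroup)
  have v: "v \<in> lists (states M \<times> UNIV)" and "u \<in> lists (states M \<times> UNIV)"
    using uv by (auto simp: free_group_def)
  from this(2) have "free_action M (foldr push_letter u v) =
      free_action M u \<otimes>\<^bsub>BijGroup (lists (alphabet M))\<^esub> free_action M v"
  proof (induction u)
    case Nil
    show ?case using free_action_in_BijGroup[OF assms v] by (simp add: free_action_def)
  next
    case (Cons x u)
    have "free_action M (x # u) =
        letter_action M x \<otimes>\<^bsub>BijGroup (lists (alphabet M))\<^esub> free_action M u"
      by (simp add: free_action_def)
    then show ?case
      using Cons v free_action_push[OF assms, of x "foldr push_letter u v"]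
        free_action_in_BijGroup[OF assms, of u] free_action_in_BijGroup[OF assms, of v]
        letter_action_in_BijGroup[OF assms, of x] foldr_push_in_lists[of u "states M" v]
      by (simp add: B.m_assoc del: mem_Times_iff in_lists_conv_set)
  qed
  then show "free_action M (u \<otimes>\<^bsub>free_group (states M)\<^esub> v) =
      free_action M u \<otimes>\<^bsub>BijGroup (lists (alphabet M))\<^esub> free_action M v"
    by (simp add: free_group_def)
qed (simp add: free_group_def free_action_in_BijGroup assms)

lemma group_automaton_group:
  assumes "mealy_automaton M" "invertible_automaton M"
  shows "group (automaton_group M)"
  unfolding automaton_group_def
  by (intro normal.factorgroup_is_group group_hom.normal_kernel free_action_hom assms)

end

theory Submission
  imports Defs
begin

text \<open>
  Let \<open>G\<close> be the group of a bireversible automaton over the alphabet \<open>A\<close>. Every \<open>g\<close> in \<open>G\<close>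
  has a section at every word \<open>u\<close>, the element that describes how \<open>g\<close> acts on what follows
  \<open>u\<close>. Bireversibility makes taking the section at \<open>u\<close> a permutation of the signed words of
  each length over the states, hence a permutation of \<open>G\<close> all of whose orbits are finite. A
  section of a product of \<open>k\<close> generators is a product of \<open>k\<close> sections of generators, so an
  element of length \<open>k\<close> has at most \<open>M ^ k\<close> sections. It is therefore enough that the number
  of sections of \<open>g ^ n\<close> grows exponentially in \<open>n\<close> whenever \<open>g\<close> has infinite order.

  To count them, view \<open>G\<close> as a set of points on which a group of permutations acts that
  contains the section maps and the right translations. The sections of \<open>x\<close> are the orbit of
  \<open>x\<close> under the stabilizer of \<open>1\<close>. So the number of sections of \<open>g ^ n\<close> is an index of
  stabilizers, and translation by \<open>g\<close> shifts the orbit of points \<open>p i = g ^ i\<close>. For such an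
  orbit the indices \<open>[Fix(p 0) : Fix(p 0, p n)]\<close> are bounded or grow exponentially in \<open>n\<close>.
  This is the combinatorial core (theorem \<open>bounded_or_exponential\<close>); it is an elementary
  form of the theory of the scale function of totally disconnected locally compact groups
  (Willis), in the spirit of its permutational treatment by Moeller.

  In the bounded case \<open>g\<close> has finite order: an element with at most \<open>b\<close> sections is a state
  of an automaton with at most \<open>b\<close> states, and among such elements it is determined by its
  action on the words of length at most \<open>b * b\<close>. There are finitely many such elements, so
  the powers of \<open>g\<close> repeat (lemma \<open>finite_bounded_sections\<close>).
\<close>

section \<open>Growth of stabilizer indices along an orbit\<close>

lemma antimono_nat_eventually_constant:
  fixes f :: "nat \<Rightarrow> nat"
  assumes "\<And>n. f (Suc n) \<le> f n"
  shows "\<exists>N c. \<forall>n\<ge>N. f n = c"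
proof -
  define c where "c = (LEAST x. x \<in> range f)"
  obtain N where N: "f N = c"
    using LeastI[of "\<lambda>x. x \<in> range f" "f 0"] by (auto simp: c_def)
  have "f n = c" if "n \<ge> N" for n
  proof (rule antisym)
    show "f n \<le> c"
      using lift_Suc_antimono_le[of f N n] assms that N by simp
    show "c \<le> f n"
      by (simp add: c_def Least_le)
  qed
  then show ?thesis by blast
qed

text \<open>The intended model: a group of permutations contains \<open>\<tau>\<close>, the points \<open>p i\<close> for integers
  \<open>i\<close> form an orbit of \<open>\<tau>\<close>, and \<open>idx I J\<close> is the index of the pointwise stabilizer of \<open>p ` (I \<union>
  J)\<close> in that of \<open>p ` I\<close>. These four properties are all that the growth argument uses, and with
  them it becomes arithmetic. The base \<open>I\<close> has to be nonempty because only stabilizers of points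
  have finite orbits.\<close>

locale orbit_index =
  fixes idx :: "int set \<Rightarrow> int set \<Rightarrow> nat"
  assumes idx_pos: "\<lbrakk>I \<noteq> {}; finite J\<rbrakk> \<Longrightarrow> 0 < idx I J"
    and idx_tower: "\<lbrakk>I \<noteq> {}; finite J; finite K\<rbrakk> \<Longrightarrow> idx I (J \<union> K) = idx I J * idx (I \<union> J) K"
    and idx_antimono: "\<lbrakk>I \<noteq> {}; I \<subseteq> I'; finite J\<rbrakk> \<Longrightarrow> idx I' J \<le> idx I J"
    and idx_shift: "\<lbrakk>I \<noteq> {}; finite J\<rbrakk> \<Longrightarrow> idx ((+) 1 ` I) ((+) 1 ` J) = idx I J"
begin

lemma idx_mono:
  assumes "I \<noteq> {}" "finite J'" "J \<subseteq> J'"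
  shows "idx I J \<le> idx I J'"
proof -
  have "finite J" using assms finite_subset by blast
  then have "idx I (J \<union> J') = idx I J * idx (I \<union> J) J'"
    using assms by (intro idx_tower) auto
  moreover have "idx (I \<union> J) J' > 0"
    using assms by (intro idx_pos) auto
  ultimately show ?thesis
    using assms by (simp add: Un_absorb1)
qed

lemma idx_swap:
  assumes "I \<noteq> {}" "finite J" "finite K"
  shows "idx I J * idx (I \<union> J) K = idx I K * idx (I \<union> K) J"
  using assms idx_tower[of I J K] idx_tower[of I K J] by (simp add: Un_commute)

lemma idx_shift_nat:
  assumes "I \<noteq> {}" "finite J"
  shows "idx ((+) (int k) ` I) ((+) (int k) ` J) = idx I J"
proof (induction k)
  case (Suc k)
  have e: "(+) (int (Suc k)) ` Y = (+) 1 ` (+) (int k) ` Y" for Y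
    by (simp add: image_image add.assoc)
  have "idx ((+) 1 ` (+) (int k) ` I) ((+) 1 ` (+) (int k) ` J)
      = idx ((+) (int k) ` I) ((+) (int k) ` J)"
    using assms by (intro idx_shift) auto
  then show ?case
    unfolding e Suc.IH .
qed simp

lemma idx_shift_intervals:
  assumes "a \<le> b" "finite J"
  shows "idx {a + int k..b + int k} ((+) (int k) ` J) = idx {a..b} J"
  using idx_shift_nat[of "{a..b}" J k] assms by (simp add: add.commute)

text \<open>The degrees \<open>d\<close> and \<open>d'\<close> count the ways in which a segment \<open>p 0, \<dots>, p n\<close> of the orbit can
  be prolonged by one point at its end and at its beginning. A longer segment has a smaller
  stabilizer, up to a shift if it grows at its beginning; so the two numbers decrease with \<open>n\<close>
  and become constant.\<close>

lemma stable_degrees: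
  obtains N d d' where
    "\<And>n. N \<le> n \<Longrightarrow> idx {0..int n} {int n + 1} = d"
    "\<And>n. N \<le> n \<Longrightarrow> idx {1..int n + 1} {0} = d'"
proof -
  have "idx {0..int (Suc n)} {int (Suc n) + 1} \<le> idx {0..int n} {int n + 1}" for n
  proof -
    have "idx {0..int (Suc n)} {int (Suc n) + 1} \<le> idx {1..int (Suc n)} {int (Suc n) + 1}"
      by (intro idx_antimono) auto
    also have "\<dots> = idx {0..int n} {int n + 1}"
      using idx_shift_intervals[of 0 "int n" "{int n + 1}" 1] by (simp add: add.commute)
    finally show ?thesis .
  qed
  then obtain N1 d where d: "\<forall>n\<ge>N1. idx {0..int n} {int n + 1} = d"
    using antimono_nat_eventually_constant[of "\<lambda>n. idx {0..int n} {int n + 1}"] by blast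
  have "idx {1..int (Suc n) + 1} {0} \<le> idx {1..int n + 1} {0}" for n
    by (intro idx_antimono) auto
  then obtain N2 d' where d': "\<forall>n\<ge>N2. idx {1..int n + 1} {0} = d'"
    using antimono_nat_eventually_constant[of "\<lambda>n. idx {1..int n + 1} {0}"] by blast
  show thesis
    by (rule that[of "max N1 N2" d d']) (use d d' in auto)
qed

text \<open>Group \<open>N + 1\<close> consecutive points into blocks \<open>B n\<close>, with \<open>N\<close> so large that the degrees are
  stable. Let \<open>t n\<close> be the number of positions of \<open>B n\<close> relative to \<open>B 0\<close>, and \<open>f n\<close> the number
  of positions of the point \<open>n\<close> relative to \<open>B 0\<close> and \<open>B (n + 1)\<close> together. Each position of \<open>B
  n\<close> can be prolonged in \<open>d\<close> ways and each position of \<open>B (n + 1)\<close> is reached from \<open>f n\<close>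
  positions of \<open>B n\<close>, so \<open>t n * d = t (n + 1) * f n\<close>. The numbers \<open>f n\<close> increase. If one of them
  reaches \<open>d\<close>, then \<open>t\<close> does not grow from there on; otherwise \<open>f n \<le> d - 1\<close> for all \<open>n\<close>, and
  \<open>t\<close> grows at each step at least by the factor \<open>d / (d - 1)\<close>.\<close>

theorem bounded_or_exponential:
  "(\<exists>b. \<forall>n. idx {0} {int n} \<le> b) \<or>
    (\<exists>c \<beta> :: real. 0 < c \<and> 1 < \<beta> \<and> (\<forall>n. c * \<beta> ^ n \<le> idx {0} {int n}))"
proof -
  obtain N d d' where d: "\<And>n. N \<le> n \<Longrightarrow> idx {0..int n} {int n + 1} = d"
    and d': "\<And>n. N \<le> n \<Longrightarrow> idx {1..int n + 1} {0} = d'"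
    using stable_degrees by metis
  define B where "B n = {int n..int n + int N}" for n
  have B_ne: "B n \<noteq> {}" and B_fin: "finite (B n)" for n
    by (auto simp: B_def)
  define t where "t n = idx (B 0) (B n)" for n
  define f where "f n = idx (B 0 \<union> B (Suc n)) {int n}" for n
  \<comment> \<open>The degree is the same over every base between the last block and a whole segment, since it
    is \<open>d\<close> for both.\<close>
  have fwd: "idx I {int n + int N + 1} = d" if I: "B n \<subseteq> I" "I \<subseteq> {0..int n + int N}" for n I
  proof (rule antisym)
    have "idx I {int n + int N + 1} \<le> idx (B n) {int n + int N + 1}"
      using I B_ne[of n] by (intro idx_antimono) auto
    also have "\<dots> = idx {0..int N} {int N + 1}"
      using idx_shift_intervals[of 0 "int N" "{int N + 1}" n] by (simp add: B_def add.commute add.left_commute)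
    finally show "idx I {int n + int N + 1} \<le> d"
      using d by simp
    have "idx {0..int (n + N)} {int (n + N) + 1} \<le> idx I {int n + int N + 1}"
      using I B_ne[of n] by (simp, intro idx_antimono) auto
    then show "d \<le> idx I {int n + int N + 1}"
      using d[of "n + N"] by simp
  qed
  have bwd: "idx I {0} = d'" if I: "B 1 \<subseteq> I" "I \<subseteq> {1..int n + int N + 1}" for n I
  proof (rule antisym)
    have "idx I {0} \<le> idx (B 1) {0}"
      using I B_ne[of 1] by (intro idx_antimono) auto
    then show "idx I {0} \<le> d'"
      using d'[of N] by (simp add: B_def add.commute)
    have "idx {1..int (n + N) + 1} {0} \<le> idx I {0}"
      using I B_ne[of 1] by (intro idx_antimono) auto
    then show "d' \<le> idx I {0}"
      using d'[of "n + N"] by simp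
  qed
  have t_pos: "0 < t n" for n
    unfolding t_def by (intro idx_pos B_ne B_fin)
  have f_pos: "0 < f n" for n
    unfolding f_def by (intro idx_pos) (auto simp: B_ne)
  \<comment> \<open>Both sides are the index obtained by fixing \<open>B n \<union> B (n + 1)\<close> in addition to \<open>B 0\<close>.\<close>
  have step: "t n * d = t (Suc n) * f n" for n
  proof -
    have "t n * d = idx (B 0) (B n) * idx (B 0 \<union> B n) {int n + int N + 1}"
      by (subst fwd) (auto simp: t_def B_def)
    also have "\<dots> = idx (B 0) (B n \<union> {int n + int N + 1})"
      by (rule idx_tower[symmetric]) (auto simp: B_ne B_fin)
    also have "B n \<union> {int n + int N + 1} = B (Suc n) \<union> {int n}"
      by (auto simp: B_def)
    also have "idx (B 0) \<dots> = t (Suc n) * f n"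
      unfolding t_def f_def by (rule idx_tower) (auto simp: B_ne B_fin)
    finally show ?thesis .
  qed
  have d'_pos: "0 < d'"
    using d'[of N] idx_pos[of "{1..int N + 1}" "{0}"] by simp
  \<comment> \<open>There are \<open>d'\<close> positions of the point \<open>0\<close> relative to \<open>B 1\<close>, no matter which later points
    are fixed as well. Hence fixing \<open>0\<close> in addition to \<open>B 1\<close> and \<open>B (n + 2)\<close> does not change the
    number of positions of the point \<open>n + 1\<close>, while replacing \<open>{0} \<union> B 1\<close> by its part \<open>B 0\<close> can
    only increase it.\<close>
  have f_mono: "f n \<le> f (Suc n)" for n
  proof -
    define I where "I = B 1 \<union> B (Suc (Suc n))"
    have "I \<noteq> {}" by (simp add: I_def B_ne)
    have "f n = idx I {int n + 1}"
    proof -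
      have shift: "(+) 1 ` B k = B (Suc k)" for k
        unfolding B_def by (simp add: add.commute add.left_commute)
      have "f n = idx ((+) 1 ` (B 0 \<union> B (Suc n))) ((+) 1 ` {int n})"
        unfolding f_def by (rule idx_shift[symmetric]) (auto simp: B_ne)
      also have "\<dots> = idx I {int n + 1}"
        unfolding I_def image_Un shift by (simp add: add.commute)
      finally show ?thesis .
    qed
    moreover have "idx I {int n + 1} * idx (I \<union> {int n + 1}) {0}
        = idx I {0} * idx (I \<union> {0}) {int n + 1}"
      using \<open>I \<noteq> {}\<close> by (intro idx_swap) auto
    moreover have "idx I {0} = d'" "idx (I \<union> {int n + 1}) {0} = d'"
      by (rule bwd[of _ "Suc n"]; auto simp: I_def B_def)+
    moreover have "idx (I \<union> {0}) {int n + 1} \<le> idx (B 0 \<union> B (Suc (Suc n))) {int n + 1}"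
      by (rule idx_antimono) (auto simp: B_ne, auto simp: I_def B_def)
    ultimately show ?thesis
      using d'_pos by (simp add: f_def add.commute)
  qed
  define p where "p = idx {0} (B 0)"
  have p_pos: "0 < p" unfolding p_def by (intro idx_pos B_fin) auto
  \<comment> \<open>Passing from points to blocks costs only the constant factor \<open>p\<close>.\<close>
  have s_le: "idx {0} {int n} \<le> p * t n" for n
  proof -
    have "idx {0} {int n} \<le> idx {0} (B 0 \<union> {int n})"
      by (intro idx_mono) (auto simp: B_fin)
    also have "\<dots> = p * idx ({0} \<union> B 0) {int n}"
      unfolding p_def by (rule idx_tower) (auto simp: B_fin)
    also have "{0} \<union> B 0 = B 0" by (auto simp: B_def)
    also have "idx (B 0) {int n} \<le> t n"
      unfolding t_def by (intro idx_mono B_ne B_fin) (auto simp: B_def)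
    finally show ?thesis by simp
  qed
  have t_le: "t n \<le> p * idx {0} {int n}" for n
  proof -
    have "t n \<le> idx {0} (B n)"
      unfolding t_def by (intro idx_antimono B_fin) (auto simp: B_def)
    also have "B n = {int n} \<union> B n" by (auto simp: B_def)
    also have "idx {0} \<dots> = idx {0} {int n} * idx ({0} \<union> {int n}) (B n)"
      by (rule idx_tower) (auto simp: B_fin)
    also have "idx ({0} \<union> {int n}) (B n) \<le> idx {int n} (B n)"
      by (intro idx_antimono B_fin) auto
    also have "\<dots> = p"
      using idx_shift_intervals[of 0 0 "B 0" n] by (simp add: p_def B_def add.commute add.left_commute)
    finally show ?thesis by (simp add: mult.commute)
  qed
  show ?thesis
  proof (cases "\<exists>M. d \<le> f M")
    case True
    then obtain M where M: "d \<le> f M" by blast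
    have "0 < t 0 * d"
      using step[of 0] t_pos[of 1] f_pos[of 0] by simp
    then have "0 < d" by simp
    have decr: "t (Suc n) \<le> t n" if "n \<ge> M" for n
    proof -
      have "d \<le> f n"
        using lift_Suc_mono_le[of f M n, OF f_mono that] M by simp
      then have "t (Suc n) * d \<le> t n * d"
        using step[of n] mult_le_mono2[of d "f n" "t (Suc n)"] by simp
      then show ?thesis using \<open>0 < d\<close> by simp
    qed
    have t_decr: "t (M + k) \<le> t M" for k
    proof (induction k)
      case (Suc k)
      then show ?case using decr[of "M + k"] by simp
    qed simp
    have "t n \<le> Max (t ` {..M})" for n
    proof (cases "n \<le> M")
      case False
      then have "t n \<le> t M" using t_decr[of "n - M"] by simp
      also have "t M \<le> Max (t ` {..M})" by simp
      finally show ?thesis .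
    qed simp
    then have "idx {0} {int n} \<le> p * Max (t ` {..M})" for n
      using s_le[of n] mult_le_mono2 order_trans by blast
    then show ?thesis by blast
  next
    case False
    then have lt: "f n < d" for n
      by (simp add: not_le)
    then have d2: "1 < d" using f_pos[of 0] lt[of 0] by linarith
    define \<beta> where "\<beta> = real d / (real d - 1)"
    have beta: "1 < \<beta>" using d2 by (simp add: \<beta>_def field_simps)
    have grow: "\<beta> * real (t n) \<le> real (t (Suc n))" for n
    proof -
      have "real (t n) * real d = real (t (Suc n)) * real (f n)"
        using step[of n] by (metis of_nat_mult)
      also have "\<dots> \<le> real (t (Suc n)) * (real d - 1)"
        using lt[of n] by (intro mult_left_mono) auto
      finally show ?thesis
        using d2 by (simp add: \<beta>_def field_simps)
    qed
    have "\<beta> ^ n \<le> real (t n)" for n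
    proof (induction n)
      case 0
      show ?case using t_pos[of 0] by simp
    next
      case (Suc n)
      have "\<beta> ^ Suc n \<le> \<beta> * real (t n)"
        using Suc beta by simp
      then show ?case using grow[of n] by linarith
    qed
    moreover have "real (t n) \<le> real p * real (idx {0} {int n})" for n
      using t_le[of n] by (metis of_nat_le_iff of_nat_mult)
    ultimately have "\<beta> ^ n \<le> real p * real (idx {0} {int n})" for n
      using order_trans by blast
    then have "1 / real p * \<beta> ^ n \<le> real (idx {0} {int n})" for n
      using p_pos by (simp add: field_simps)
    then show ?thesis
      using p_pos beta by (intro disjI2 exI[of _ "1 / real p"] exI[of _ \<beta>]) auto
  qed
qed

end

section \<open>Indices of pointwise stabilizers\<close>

text \<open>A group \<open>\<Lambda>\<close> of permutations whose point stabilizers have finite orbits, and an orbit \<open>p\<close>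
  of one of its elements \<open>\<tau>\<close>.\<close>

locale permutations_along_orbit =
  fixes \<Lambda> :: "('x \<Rightarrow> 'x) set" and \<tau> :: "'x \<Rightarrow> 'x" and p :: "int \<Rightarrow> 'x"
  assumes id_mem: "id \<in> \<Lambda>"
    and comp_mem: "\<lbrakk>f \<in> \<Lambda>; g \<in> \<Lambda>\<rbrakk> \<Longrightarrow> f \<circ> g \<in> \<Lambda>"
    and bij_mem: "f \<in> \<Lambda> \<Longrightarrow> bij f"
    and inv_mem: "f \<in> \<Lambda> \<Longrightarrow> inv_into UNIV f \<in> \<Lambda>"
    and \<tau>_mem: "\<tau> \<in> \<Lambda>"
    and \<tau>_orbit: "\<tau> (p i) = p (1 + i)"
    and finite_orbit: "finite ((\<lambda>f. f (p j)) ` {f \<in> \<Lambda>. f (p i) = p i})"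
begin

definition stab :: "int set \<Rightarrow> ('x \<Rightarrow> 'x) set" where
  "stab I = {f \<in> \<Lambda>. \<forall>i\<in>I. f (p i) = p i}"

text \<open>The orbit of the tuple \<open>(p j)\<close>, for \<open>j\<close> in \<open>J\<close>, under the stabilizer of the points with
  index in \<open>I\<close>. By the orbit-stabilizer theorem its size is the index of one stabilizer in the
  other, so that no cosets are needed. Tuples are functions on \<open>J\<close> because index sets then need
  not be ordered.\<close>

definition joint_orbit :: "int set \<Rightarrow> int set \<Rightarrow> (int \<Rightarrow> 'x) set" where
  "joint_orbit I J = (\<lambda>f. restrict (f \<circ> p) J) ` stab I"

lemma inv_cancel: "f \<in> \<Lambda> \<Longrightarrow> inv_into UNIV f (f x) = x" "f \<in> \<Lambda> \<Longrightarrow> f (inv_into UNIV f x) = x"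
  using bij_mem by (auto simp: bij_is_inj bij_is_surj surj_f_inv_f)

lemma joint_orbit_finite:
  assumes "I \<noteq> {}" "finite J"
  shows "finite (joint_orbit I J)"
proof -
  obtain i where "i \<in> I" using assms by blast
  then have "joint_orbit I J \<subseteq> PiE J (\<lambda>j. (\<lambda>f. f (p j)) ` {f \<in> \<Lambda>. f (p i) = p i})"
    by (auto simp: joint_orbit_def stab_def)
  then show ?thesis
    using assms finite_orbit by (meson finite_PiE finite_subset)
qed

text \<open>If \<open>f\<close> carries the \<open>J\<close>-tuple to \<open>a\<close>, then the elements that do so form the coset of \<open>f\<close>
  with respect to the stabilizer of \<open>I \<union> J\<close>. All fibres of the projection to \<open>J\<close>-tuples thus
  have equal size, which gives the tower law.\<close>

lemma joint_orbit_fibre_card: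
  assumes "a \<in> joint_orbit I J"
  shows "card ((\<lambda>f. restrict (f \<circ> p) K) ` {f \<in> stab I. restrict (f \<circ> p) J = a})
    = card (joint_orbit (I \<union> J) K)"
proof -
  obtain f where f: "f \<in> stab I" and a: "a = restrict (f \<circ> p) J"
    using assms by (auto simp: joint_orbit_def)
  then have fL: "f \<in> \<Lambda>" by (simp add: stab_def)
  have "{g \<in> stab I. restrict (g \<circ> p) J = a} = (\<lambda>h. f \<circ> h) ` stab (I \<union> J)"
  proof (intro equalityI subsetI)
    fix g assume g: "g \<in> {g \<in> stab I. restrict (g \<circ> p) J = a}"
    then have "g (p j) = f (p j)" if "j \<in> I \<union> J" for j
      using f that unfolding a stab_def by (auto dest: fun_cong[of _ _ j])
    then have "inv_into UNIV f \<circ> g \<in> stab (I \<union> J)"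
      using g fL by (auto simp: stab_def comp_mem inv_mem inv_cancel)
    moreover have "g = f \<circ> (inv_into UNIV f \<circ> g)"
      using fL by (simp add: fun_eq_iff inv_cancel)
    ultimately show "g \<in> (\<lambda>h. f \<circ> h) ` stab (I \<union> J)" by blast
  next
    fix g assume "g \<in> (\<lambda>h. f \<circ> h) ` stab (I \<union> J)"
    then show "g \<in> {g \<in> stab I. restrict (g \<circ> p) J = a}"
      using f fL unfolding a by (auto simp: stab_def comp_mem fun_eq_iff)
  qed
  note * = this
  have "(\<lambda>g. restrict (g \<circ> p) K) ` {g \<in> stab I. restrict (g \<circ> p) J = a}
      = (\<lambda>c. restrict (f \<circ> c) K) ` joint_orbit (I \<union> J) K"
  proof -
    have "restrict (f \<circ> h \<circ> p) K = restrict (f \<circ> restrict (h \<circ> p) K) K" for h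
      by (simp add: restrict_def fun_eq_iff)
    then show ?thesis
      using * by (simp only: joint_orbit_def image_image)
  qed
  moreover have "inj_on (\<lambda>c. restrict (f \<circ> c) K) (joint_orbit (I \<union> J) K)"
  proof (rule inj_onI)
    fix c c' assume c: "c \<in> joint_orbit (I \<union> J) K" "c' \<in> joint_orbit (I \<union> J) K"
      and eq: "restrict (f \<circ> c) K = restrict (f \<circ> c') K"
    have "c k = c' k" if "k \<in> K" for k
      using fun_cong[OF eq, of k] that fL inv_cancel(1)[OF fL] by (simp, metis)
    moreover have "c \<in> extensional K" "c' \<in> extensional K"
      using c by (auto simp: joint_orbit_def)
    ultimately show "c = c'" by (meson extensionalityI)
  qed
  ultimately show ?thesis by (simp add: card_image)
qed

lemma joint_orbit_tower:
  assumes "I \<noteq> {}" "finite J" "finite K"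
  shows "card (joint_orbit I (J \<union> K)) = card (joint_orbit I J) * card (joint_orbit (I \<union> J) K)"
proof -
  let ?B = "\<lambda>a. (\<lambda>f. restrict (f \<circ> p) K) ` {f \<in> stab I. restrict (f \<circ> p) J = a}"
  let ?r = "\<lambda>h. (restrict h J, restrict h K)"
  have "inj_on ?r (joint_orbit I (J \<union> K))"
  proof (rule inj_onI)
    fix c c' assume c: "c \<in> joint_orbit I (J \<union> K)" "c' \<in> joint_orbit I (J \<union> K)" and eq: "?r c = ?r c'"
    have "c k = c' k" if "k \<in> J \<union> K" for k
      using eq that by (auto dest: fun_cong[of _ _ k])
    moreover have "c \<in> extensional (J \<union> K)" "c' \<in> extensional (J \<union> K)"
      using c by (auto simp: joint_orbit_def)
    ultimately show "c = c'" by (meson extensionalityI)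
  qed
  then have "card (joint_orbit I (J \<union> K)) = card (?r ` joint_orbit I (J \<union> K))"
    by (simp add: card_image)
  also have "?r ` joint_orbit I (J \<union> K) = (\<lambda>f. (restrict (f \<circ> p) J, restrict (f \<circ> p) K)) ` stab I"
    by (simp add: joint_orbit_def image_image Int_absorb1)
  also have "\<dots> = Sigma (joint_orbit I J) ?B"
  proof (intro equalityI subsetI)
    fix x assume "x \<in> Sigma (joint_orbit I J) ?B"
    then obtain f where "f \<in> stab I" "x = (restrict (f \<circ> p) J, restrict (f \<circ> p) K)"
      by force
    then show "x \<in> (\<lambda>f. (restrict (f \<circ> p) J, restrict (f \<circ> p) K)) ` stab I" by blast
  qed (auto simp: joint_orbit_def)
  also have "card \<dots> = (\<Sum>a\<in>joint_orbit I J. card (?B a))"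
  proof (rule card_SigmaI)
    show "finite (joint_orbit I J)" using assms by (simp add: joint_orbit_finite)
    have "?B a \<subseteq> joint_orbit I K" for a by (auto simp: joint_orbit_def)
    then show "\<forall>a\<in>joint_orbit I J. finite (?B a)"
      using assms by (blast intro: finite_subset[OF _ joint_orbit_finite[of I K]])
  qed
  also have "\<dots> = (\<Sum>a\<in>joint_orbit I J. card (joint_orbit (I \<union> J) K))"
    by (intro sum.cong refl joint_orbit_fibre_card)
  finally show ?thesis by simp
qed

text \<open>Conjugation by \<open>\<tau>\<close> carries the stabilizer of \<open>I\<close> to that of \<open>I + 1\<close>.\<close>

lemma joint_orbit_shift: "card (joint_orbit ((+) 1 ` I) ((+) 1 ` J)) = card (joint_orbit I J)"
proof -
  let ?s = "\<lambda>c. restrict (\<lambda>j. \<tau> (c (j - 1))) ((+) 1 ` J)"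
  have inv_\<tau>: "inv_into UNIV \<tau> (p (1 + i)) = p i" for i
    by (metis \<tau>_orbit inv_cancel(1) \<tau>_mem)
  have "joint_orbit ((+) 1 ` I) ((+) 1 ` J) = ?s ` joint_orbit I J"
  proof (intro equalityI subsetI)
    fix c assume "c \<in> joint_orbit ((+) 1 ` I) ((+) 1 ` J)"
    then obtain f where f: "f \<in> stab ((+) 1 ` I)" and c: "c = restrict (f \<circ> p) ((+) 1 ` J)"
      by (auto simp: joint_orbit_def)
    let ?g = "inv_into UNIV \<tau> \<circ> f \<circ> \<tau>"
    have "?g \<in> stab I"
      using f by (auto simp: stab_def comp_mem inv_mem \<tau>_mem \<tau>_orbit inv_\<tau>)
    moreover have "c = ?s (restrict (?g \<circ> p) J)"
      unfolding c by (auto simp: fun_eq_iff inv_cancel \<tau>_mem \<tau>_orbit)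
    ultimately show "c \<in> ?s ` joint_orbit I J"
      unfolding joint_orbit_def by blast
  next
    fix c assume "c \<in> ?s ` joint_orbit I J"
    then obtain f where f: "f \<in> stab I" and c: "c = ?s (restrict (f \<circ> p) J)"
      by (auto simp: joint_orbit_def)
    let ?g = "\<tau> \<circ> f \<circ> inv_into UNIV \<tau>"
    have "?g \<in> stab ((+) 1 ` I)"
      using f by (auto simp: stab_def comp_mem inv_mem \<tau>_mem \<tau>_orbit inv_\<tau>)
    moreover have "c = restrict (?g \<circ> p) ((+) 1 ` J)"
      unfolding c by (auto simp: fun_eq_iff inv_\<tau>)
    ultimately show "c \<in> joint_orbit ((+) 1 ` I) ((+) 1 ` J)"
      unfolding joint_orbit_def by blast
  qed
  moreover have "inj_on ?s (joint_orbit I J)"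
  proof (rule inj_onI)
    fix c c' assume c: "c \<in> joint_orbit I J" "c' \<in> joint_orbit I J" and eq: "?s c = ?s c'"
    have "c j = c' j" if "j \<in> J" for j
      using fun_cong[OF eq, of "1 + j"] that inv_cancel(1)[OF \<tau>_mem] by (simp, metis)
    moreover have "c \<in> extensional J" "c' \<in> extensional J"
      using c by (auto simp: joint_orbit_def)
    ultimately show "c = c'" by (meson extensionalityI)
  qed
  ultimately show ?thesis by (simp add: card_image)
qed

sublocale orbit_index "\<lambda>I J. card (joint_orbit I J)"
proof
  fix I J :: "int set" assume IJ: "I \<noteq> {}" "finite J"
  have "id \<in> stab I" by (simp add: stab_def id_mem)
  then show "0 < card (joint_orbit I J)"
    using joint_orbit_finite[OF IJ] by (auto simp: card_gt_0_iff joint_orbit_def)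
next
  fix I I' J :: "int set" assume "I \<noteq> {}" "I \<subseteq> I'" "finite J"
  moreover have "joint_orbit I' J \<subseteq> joint_orbit I J"
    using \<open>I \<subseteq> I'\<close> by (auto simp: joint_orbit_def stab_def)
  ultimately show "card (joint_orbit I' J) \<le> card (joint_orbit I J)"
    by (intro card_mono joint_orbit_finite)
qed (auto simp: joint_orbit_tower joint_orbit_shift)

lemma card_joint_orbit_singletons:
  "card (joint_orbit {i} {j}) = card ((\<lambda>f. f (p j)) ` {f \<in> \<Lambda>. f (p i) = p i})"
proof -
  have "(\<lambda>f. f (p j)) ` {f \<in> \<Lambda>. f (p i) = p i} = (\<lambda>c. c j) ` joint_orbit {i} {j}"
    by (auto simp: joint_orbit_def stab_def image_image)
  moreover have "inj_on (\<lambda>c. c j) (joint_orbit {i} {j})"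
    by (rule inj_onI) (auto simp: joint_orbit_def fun_eq_iff)
  ultimately show ?thesis by (simp add: card_image)
qed

end

section \<open>Word length in a finitely generated group\<close>

context group
begin

lemma foldr_mult_closed: "set ws \<subseteq> carrier G \<Longrightarrow> foldr (\<otimes>) ws \<one> \<in> carrier G"
  by (induction ws) auto

lemma foldr_mult_append:
  "set us \<subseteq> carrier G \<Longrightarrow> set vs \<subseteq> carrier G \<Longrightarrow>
    foldr (\<otimes>) (us @ vs) \<one> = foldr (\<otimes>) us \<one> \<otimes> foldr (\<otimes>) vs \<one>"
  by (induction us) (auto simp: m_assoc foldr_mult_closed simp del: foldr_append)

lemma letters_subset: "finite_generating_set G S \<Longrightarrow> S \<union> m_inv G ` S \<subseteq> carrier G"
  by (auto simp: finite_generating_set_def)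

lemma exists_word:
  assumes S: "finite_generating_set G S" and "g \<in> carrier G"
  shows "\<exists>ws. set ws \<subseteq> S \<union> m_inv G ` S \<and> foldr (\<otimes>) ws \<one> = g"
proof -
  have sub: "S \<union> m_inv G ` S \<subseteq> carrier G"
    using S by (rule letters_subset)
  have "g \<in> generate G S"
    using assms by (simp add: finite_generating_set_def)
  then show ?thesis
  proof induction
    case one
    show ?case by (intro exI[of _ "[]"]) simp
  next
    case (incl h)
    then show ?case using sub by (intro exI[of _ "[h]"]) auto
  next
    case (inv h)
    then show ?case using sub by (intro exI[of _ "[m_inv G h]"]) auto
  next
    case (eng h1 h2)
    then obtain us vs where "set us \<subseteq> S \<union> m_inv G ` S" "foldr (\<otimes>) us \<one> = h1"
      "set vs \<subseteq> S \<union> m_inv G ` S" "foldr (\<otimes>) vs \<one> = h2" by blast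
    then show ?case
      using sub foldr_mult_append[of us vs] by (intro exI[of _ "us @ vs"]) auto
  qed
qed

lemma word_length_le:
  assumes "set ws \<subseteq> S \<union> m_inv G ` S" "foldr (\<otimes>) ws \<one> = g"
  shows "word_length G S g \<le> length ws"
  unfolding word_length_def using assms by (intro Least_le) blast

lemma shortest_word:
  assumes "finite_generating_set G S" "g \<in> carrier G"
  obtains ws where "length ws = word_length G S g" "set ws \<subseteq> S \<union> m_inv G ` S"
    "foldr (\<otimes>) ws \<one> = g"
proof -
  have "\<exists>n ws. length ws = n \<and> set ws \<subseteq> S \<union> m_inv G ` S \<and> foldr (\<otimes>) ws \<one> = g"
    using exists_word[OF assms] by blast
  then have "\<exists>ws. length ws = word_length G S g \<and> set ws \<subseteq> S \<union> m_inv G ` S \<and>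
      foldr (\<otimes>) ws \<one> = g"
    unfolding word_length_def by (rule LeastI_ex)
  then show thesis using that by blast
qed

lemma word_length_one: "word_length G S \<one> = 0"
  using word_length_le[of "[]" S \<one>] by simp

lemma word_length_eq_0:
  assumes "finite_generating_set G S" "g \<in> carrier G" "word_length G S g = 0"
  shows "g = \<one>"
  using shortest_word[OF assms(1,2)] assms(3) by force

lemma word_length_mult:
  assumes S: "finite_generating_set G S" and gh: "g \<in> carrier G" "h \<in> carrier G"
  shows "word_length G S (g \<otimes> h) \<le> word_length G S g + word_length G S h"
proof -
  obtain us where us: "length us = word_length G S g" "set us \<subseteq> S \<union> m_inv G ` S"
    "foldr (\<otimes>) us \<one> = g" using shortest_word[OF S gh(1)] .
  obtain vs where vs: "length vs = word_length G S h" "set vs \<subseteq> S \<union> m_inv G ` S"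
    "foldr (\<otimes>) vs \<one> = h" using shortest_word[OF S gh(2)] .
  have "foldr (\<otimes>) (us @ vs) \<one> = g \<otimes> h"
    using us vs letters_subset[OF S] foldr_mult_append[of us vs] by auto
  then show ?thesis
    using word_length_le[of "us @ vs" S] us vs by simp
qed

lemma word_length_pow:
  assumes "finite_generating_set G S" "g \<in> carrier G"
  shows "word_length G S (g [^] (n::nat)) \<le> n * word_length G S g"
proof (induction n)
  case 0
  show ?case by (simp add: word_length_one)
next
  case (Suc n)
  then show ?case
    using word_length_mult[OF assms(1), of "g [^] n" g] assms(2) by simp
qed

text \<open>The word for \<open>g\<close>, reversed and with inverted letters, represents \<open>inv g\<close>.\<close>

lemma word_length_inv_le:
  assumes S: "finite_generating_set G S" and g: "g \<in> carrier G"
  shows "word_length G S (inv g) \<le> word_length G S g"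
proof -
  have inverse_word: "foldr (\<otimes>) (rev (map (m_inv G) ws)) \<one> = inv (foldr (\<otimes>) ws \<one>)"
    if "set ws \<subseteq> carrier G" for ws
    using that
  proof (induction ws)
    case (Cons x ws)
    then have "foldr (\<otimes>) (rev (map (m_inv G) ws) @ [inv x]) \<one>
        = foldr (\<otimes>) (rev (map (m_inv G) ws)) \<one> \<otimes> foldr (\<otimes>) [inv x] \<one>"
      by (intro foldr_mult_append) auto
    with Cons show ?case
      by (simp add: inv_mult_group foldr_mult_closed del: foldr_append)
  qed simp
  obtain ws where ws: "length ws = word_length G S g" "set ws \<subseteq> S \<union> m_inv G ` S"
    "foldr (\<otimes>) ws \<one> = g" using shortest_word[OF S g] .
  have "m_inv G ` (S \<union> m_inv G ` S) \<subseteq> S \<union> m_inv G ` S"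
    using S by (auto simp: finite_generating_set_def subset_iff)
  then have "set (rev (map (m_inv G) ws)) \<subseteq> S \<union> m_inv G ` S"
    using ws(2) by (simp, blast)
  then show ?thesis
    using word_length_le[of "rev (map (m_inv G) ws)" S "inv g"] inverse_word[of ws]
      ws letters_subset[OF S] by auto
qed

lemma word_length_inv:
  assumes "finite_generating_set G S" "g \<in> carrier G"
  shows "word_length G S (inv g) = word_length G S g"
  using word_length_inv_le[OF assms] word_length_inv_le[OF assms(1) inv_closed[OF assms(2)]]
    assms(2) by simp

end

section \<open>Sections of powers in a self-similar group\<close>

lemma bij_extend_by_id:
  assumes "bij_betw f B B"
  shows "bij (\<lambda>x. if x \<in> B then f x else x)"
proof (rule bijI)
  show "inj (\<lambda>x. if x \<in> B then f x else x)"
    using assms unfolding bij_betw_def by (intro injI) (auto split: if_splits dest: inj_onD)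
  show "surj (\<lambda>x. if x \<in> B then f x else x)"
    unfolding surj_def
  proof
    fix y
    show "\<exists>x. y = (if x \<in> B then f x else x)"
    proof (cases "y \<in> B")
      case True
      then obtain x where "x \<in> B" "y = f x"
        using assms by (auto simp: bij_betw_def)
      then show ?thesis by auto
    qed auto
  qed
qed

text \<open>A group acting faithfully on words, preserving lengths and prefixes: \<open>sec g u\<close> is the
  section of \<open>g\<close> at \<open>u\<close>. Two of the properties say that the group looks like that of a
  bireversible automaton: an element has finitely many sections, and iterating the section at
  \<open>u\<close> leads back to the start.\<close>

locale self_similar_group = group G for G (structure) +
  fixes A :: "'c set" and act :: "'a \<Rightarrow> 'c list \<Rightarrow> 'c list" and sec :: "'a \<Rightarrow> 'c list \<Rightarrow> 'a"
  assumes finite_alphabet: "finite A"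
    and act_closed: "\<lbrakk>g \<in> carrier G; u \<in> lists A\<rbrakk> \<Longrightarrow> act g u \<in> lists A"
    and length_act: "\<lbrakk>g \<in> carrier G; u \<in> lists A\<rbrakk> \<Longrightarrow> length (act g u) = length u"
    and act_one: "u \<in> lists A \<Longrightarrow> act \<one> u = u"
    and act_mult: "\<lbrakk>g \<in> carrier G; h \<in> carrier G; u \<in> lists A\<rbrakk>
      \<Longrightarrow> act (g \<otimes> h) u = act g (act h u)"
    and act_faithful: "\<lbrakk>g \<in> carrier G; h \<in> carrier G; \<And>u. u \<in> lists A \<Longrightarrow> act g u = act h u\<rbrakk>
      \<Longrightarrow> g = h"
    and sec_closed: "\<lbrakk>g \<in> carrier G; u \<in> lists A\<rbrakk> \<Longrightarrow> sec g u \<in> carrier G"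
    and act_append: "\<lbrakk>g \<in> carrier G; u \<in> lists A; v \<in> lists A\<rbrakk>
      \<Longrightarrow> act g (u @ v) = act g u @ act (sec g u) v"
    and finite_sections: "g \<in> carrier G \<Longrightarrow> finite (sec g ` lists A)"
    and sec_periodic: "\<lbrakk>g \<in> carrier G; u \<in> lists A\<rbrakk> \<Longrightarrow> \<exists>m. ((\<lambda>h. sec h u) ^^ Suc m) g = g"
begin

\<comment> \<open>Membership in \<open>lists A\<close> stays folded, as the facts of the locale are stated with it.\<close>
declare in_lists_conv_set [simp del] in_listsI [rule del] in_listsD [rule del]

lemma sec_mult:
  assumes "g \<in> carrier G" "h \<in> carrier G" "u \<in> lists A"
  shows "sec (g \<otimes> h) u = sec g (act h u) \<otimes> sec h u"
proof (rule act_faithful)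
  fix v assume v: "v \<in> lists A"
  have hv: "act (sec h u) v \<in> lists A" "act h u \<in> lists A"
    using assms v by (simp_all add: act_closed sec_closed)
  have "act (g \<otimes> h) (u @ v) = act g (act h u) @ act (sec (g \<otimes> h) u) v"
    using assms v by (simp add: act_append act_mult)
  moreover have "act (g \<otimes> h) (u @ v)
      = act g (act h u) @ act (sec g (act h u)) (act (sec h u) v)"
    using assms v hv by (subst act_mult) (auto simp: act_append)
  ultimately show "act (sec (g \<otimes> h) u) v = act (sec g (act h u) \<otimes> sec h u) v"
    using assms v hv by (simp add: act_mult sec_closed)
qed (use assms in \<open>auto intro!: sec_closed act_closed\<close>)

lemma sec_append:
  assumes "g \<in> carrier G" "u \<in> lists A" "v \<in> lists A"
  shows "sec g (u @ v) = sec (sec g u) v"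
proof (rule act_faithful)
  fix w assume w: "w \<in> lists A"
  have "act g (u @ v) @ act (sec g (u @ v)) w = act g (u @ v @ w)"
    using assms w act_append[of g "u @ v" w] by simp
  also have "\<dots> = act g (u @ v) @ act (sec (sec g u) v) w"
    using assms w
    by (simp add: act_append[of g u "v @ w"] act_append[of g u v]
        act_append[of "sec g u" v w] sec_closed)
  finally show "act (sec g (u @ v)) w = act (sec (sec g u) v) w" by simp
qed (use assms in \<open>auto intro!: sec_closed\<close>)

lemma sec_Nil:
  assumes "g \<in> carrier G"
  shows "sec g [] = g"
proof (rule act_faithful)
  fix v assume "v \<in> lists A"
  then show "act (sec g []) v = act g v"
    using assms act_append[of g "[]" v] length_act[of g "[]"] by simp
qed (use assms in \<open>auto intro!: sec_closed\<close>)

lemma sec_one: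
  assumes "u \<in> lists A"
  shows "sec \<one> u = \<one>"
proof (rule act_faithful)
  fix v assume "v \<in> lists A"
  then show "act (sec \<one> u) v = act \<one> v"
    using assms act_append[of \<one> u v] by (simp add: act_one)
qed (use assms in \<open>auto intro!: sec_closed\<close>)

text \<open>Sections can be undone: if the \<open>m\<close>-fold section of \<open>g\<close> at \<open>u\<close> is \<open>g\<close>, then \<open>v\<close> consists of
  \<open>m - 1\<close> copies of \<open>u\<close>.\<close>

lemma sec_recurrent:
  assumes "g \<in> carrier G" "u \<in> lists A"
  obtains v where "v \<in> lists A" "sec (sec g u) v = g"
proof -
  \<comment> \<open>An iterated section is a section, at a concatenation.\<close>
  have iter: "\<exists>v\<in>lists A. ((\<lambda>h. sec h u) ^^ m) h = sec h v" if "h \<in> carrier G" for m h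
    using that
  proof (induction m arbitrary: h)
    case 0
    then show ?case by (auto simp: sec_Nil intro!: bexI[of _ "[]"])
  next
    case (Suc m)
    then obtain v where "v \<in> lists A" "((\<lambda>h. sec h u) ^^ m) (sec h u) = sec (sec h u) v"
      using sec_closed assms(2) by blast
    then show ?case
      using Suc.prems assms(2) sec_append[of h u v]
      by (intro bexI[of _ "u @ v"]) (simp_all del: funpow.simps add: funpow_Suc_right)
  qed
  obtain m where "((\<lambda>h. sec h u) ^^ Suc m) g = g"
    using sec_periodic assms by blast
  then have "((\<lambda>h. sec h u) ^^ m) (sec g u) = g"
    by (simp del: funpow.simps add: funpow_Suc_right)
  then show thesis
    using iter[of "sec g u" m] sec_closed[OF assms] that by metis
qed

text \<open>Iterating the section at \<open>u\<close> gives periods for \<open>g\<close> and for \<open>h\<close>; the product of two periods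
  is a common one, so \<open>g\<close> and \<open>h\<close> agree if their first sections do.\<close>

lemma bij_betw_sec:
  assumes u: "u \<in> lists A"
  shows "bij_betw (\<lambda>g. sec g u) (carrier G) (carrier G)"
proof -
  let ?s = "\<lambda>g. sec g u"
  have closed: "(?s ^^ m) g \<in> carrier G" if "g \<in> carrier G" for m g
    using that sec_closed u by (induction m) auto
  have "inj_on ?s (carrier G)"
  proof (rule inj_onI)
    fix g h assume gh: "g \<in> carrier G" "h \<in> carrier G" and eq: "?s g = ?s h"
    obtain m n where mn: "(?s ^^ Suc m) g = g" "(?s ^^ Suc n) h = h"
      using gh u sec_periodic by meson
    have mult: "(?s ^^ (k * i)) x = x" if "(?s ^^ k) x = x" for k i x
      using that by (induction i) (simp_all add: funpow_add)
    obtain l where l: "Suc m * Suc n = Suc l" by (metis mult_Suc_right add_Suc)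
    have "(?s ^^ Suc l) g = g"
      unfolding l[symmetric] using mn(1) by (rule mult)
    moreover have "(?s ^^ Suc l) h = h"
      unfolding l[symmetric] mult.commute[of "Suc m"] using mn(2) by (rule mult)
    moreover have "(?s ^^ Suc l) g = (?s ^^ Suc l) h"
      using eq by (simp only: funpow_Suc_right o_apply)
    ultimately show "g = h" by simp
  qed
  moreover have "?s ` carrier G = carrier G"
  proof (intro equalityI subsetI)
    fix g assume g: "g \<in> carrier G"
    obtain m where "(?s ^^ Suc m) g = g" using sec_periodic g u by blast
    then have "g = ?s ((?s ^^ m) g)" by simp
    then show "g \<in> ?s ` carrier G" using closed[OF g, of m] by blast
  qed (use sec_closed u in auto)
  ultimately show ?thesis by (simp add: bij_betw_def)
qed

text \<open>The permutations \<open>\<phi>\<close> of \<open>G\<close> that change each quotient \<open>x y\<inverse>\<close> into one of its sections.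
  These are the automorphisms of the Cayley graph of \<open>G\<close> in which an edge is coloured by its
  label up to sections. Both the sections (because of \<open>sec_mult\<close>) and the right translations
  have this property. Defining the group by this property, and not by generators, shows at once
  where an element that fixes \<open>1\<close> can move a point. Outside the carrier \<open>\<phi>\<close> is the identity,
  which makes it a permutation of the type.\<close>

definition section_automorphisms :: "('a \<Rightarrow> 'a) set" where
  "section_automorphisms = {\<phi>. bij \<phi> \<and> (\<forall>x. x \<notin> carrier G \<longrightarrow> \<phi> x = x) \<and>
     (\<forall>x\<in>carrier G. \<phi> x \<in> carrier G) \<and>
     (\<forall>z\<in>carrier G. \<forall>y\<in>carrier G. \<exists>u\<in>lists A. \<phi> (z \<otimes> y) = sec z u \<otimes> \<phi> y)}"

lemma section_in_automorphisms:
  assumes u: "u \<in> lists A"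
  shows "(\<lambda>x. if x \<in> carrier G then sec x u else x) \<in> section_automorphisms"
  using u bij_extend_by_id[OF bij_betw_sec[OF u]]
  by (auto simp: section_automorphisms_def sec_closed sec_mult
      intro!: bexI[of _ "act _ u"] act_closed)

lemma translation_in_automorphisms:
  assumes g: "g \<in> carrier G"
  shows "(\<lambda>x. if x \<in> carrier G then x \<otimes> g else x) \<in> section_automorphisms"
proof -
  have "bij_betw (\<lambda>x. x \<otimes> g) (carrier G) (carrier G)"
    by (rule bij_betwI[of _ _ _ "\<lambda>x. x \<otimes> inv g"]) (use g in \<open>auto simp: m_assoc\<close>)
  from bij_extend_by_id[OF this] show ?thesis
    using g by (auto simp: section_automorphisms_def m_assoc sec_Nil intro!: bexI[of _ "[]"])
qed

lemma comp_in_automorphisms: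
  assumes \<phi>: "\<phi> \<in> section_automorphisms" and \<psi>: "\<psi> \<in> section_automorphisms"
  shows "\<phi> \<circ> \<psi> \<in> section_automorphisms"
proof -
  have "\<exists>u\<in>lists A. \<phi> (\<psi> (z \<otimes> y)) = sec z u \<otimes> \<phi> (\<psi> y)" if zy: "z \<in> carrier G" "y \<in> carrier G"
    for z y
  proof -
    obtain u where u: "u \<in> lists A" "\<psi> (z \<otimes> y) = sec z u \<otimes> \<psi> y"
      using \<psi> zy unfolding section_automorphisms_def by blast
    have "\<psi> y \<in> carrier G" "sec z u \<in> carrier G"
      using \<psi> zy u sec_closed by (auto simp: section_automorphisms_def)
    then obtain v where "v \<in> lists A" "\<phi> (sec z u \<otimes> \<psi> y) = sec (sec z u) v \<otimes> \<phi> (\<psi> y)"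
      using \<phi> unfolding section_automorphisms_def by blast
    then show ?thesis
      using u zy sec_append[of z u v] by (intro bexI[of _ "u @ v"]) auto
  qed
  then show ?thesis
    using assms by (auto simp: section_automorphisms_def bij_comp)
qed

text \<open>An inverse turns sections back into the original quotients, and these are again sections
  by \<open>sec_recurrent\<close>.\<close>

lemma inverse_in_automorphisms:
  assumes \<phi>: "\<phi> \<in> section_automorphisms"
  shows "inv_into UNIV \<phi> \<in> section_automorphisms"
proof -
  let ?\<psi> = "inv_into UNIV \<phi>"
  have bij: "bij \<phi>" using \<phi> by (simp add: section_automorphisms_def)
  then have cancel: "\<phi> (?\<psi> x) = x" "?\<psi> (\<phi> x) = x" for x
    by (auto simp: bij_is_surj surj_f_inv_f bij_is_inj)
  have out: "?\<psi> x = x" if "x \<notin> carrier G" for x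
    using \<phi> that cancel(2)[of x] by (auto simp: section_automorphisms_def)
  have closed: "?\<psi> x \<in> carrier G" if "x \<in> carrier G" for x
    using \<phi> that cancel(1)[of x] by (auto simp: section_automorphisms_def)
  have "\<exists>v\<in>lists A. ?\<psi> (z \<otimes> y) = sec z v \<otimes> ?\<psi> y"
    if zy: "z \<in> carrier G" "y \<in> carrier G" for z y
  proof -
    define z' where "z' = ?\<psi> (z \<otimes> y) \<otimes> inv (?\<psi> y)"
    have z': "z' \<in> carrier G" "z' \<otimes> ?\<psi> y = ?\<psi> (z \<otimes> y)"
      using zy closed by (auto simp: z'_def m_assoc)
    then obtain u where u: "u \<in> lists A" "\<phi> (z' \<otimes> ?\<psi> y) = sec z' u \<otimes> \<phi> (?\<psi> y)"
      using \<phi> zy closed unfolding section_automorphisms_def by blast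
    then have "z = sec z' u"
      using z' zy cancel sec_closed by simp
    then obtain v where "v \<in> lists A" "sec z v = z'"
      using sec_recurrent[OF z'(1) u(1)] by blast
    then show ?thesis using z' by metis
  qed
  then show ?thesis
    using bij out closed by (auto simp: section_automorphisms_def bij_imp_bij_inv)
qed

lemma id_in_automorphisms: "id \<in> section_automorphisms"
  by (auto simp: section_automorphisms_def sec_Nil intro!: bexI[of _ "[]"])

lemma section_automorphism_at:
  assumes "\<phi> \<in> section_automorphisms" "z \<in> carrier G" "y \<in> carrier G"
  obtains u where "u \<in> lists A" "\<phi> (z \<otimes> y) = sec z u \<otimes> \<phi> y"
  using assms unfolding section_automorphisms_def by blast

text \<open>A permutation \<open>\<phi>\<close> that fixes \<open>1\<close> takes \<open>x = x 1\<inverse>\<close> to a section of \<open>x\<close>; conversely each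
  section map fixes \<open>1\<close>. This is the point where counting sections becomes computing stabilizer
  indices.\<close>

lemma stabilizer_orbit_of_one:
  assumes x: "x \<in> carrier G"
  shows "(\<lambda>\<phi>. \<phi> x) ` {\<phi> \<in> section_automorphisms. \<phi> \<one> = \<one>} = sec x ` lists A"
proof (intro equalityI subsetI)
  fix y assume "y \<in> (\<lambda>\<phi>. \<phi> x) ` {\<phi> \<in> section_automorphisms. \<phi> \<one> = \<one>}"
  then obtain \<phi> where "\<phi> \<in> section_automorphisms" "\<phi> \<one> = \<one>" "y = \<phi> x" by blast
  then show "y \<in> sec x ` lists A"
    using section_automorphism_at[of \<phi> x \<one>] x sec_closed[of x] by auto
next
  fix y assume "y \<in> sec x ` lists A"
  then obtain u where u: "u \<in> lists A" "y = sec x u" by blast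
  then show "y \<in> (\<lambda>\<phi>. \<phi> x) ` {\<phi> \<in> section_automorphisms. \<phi> \<one> = \<one>}"
    using section_in_automorphisms[of u] x
    by (intro image_eqI[of _ _ "\<lambda>x. if x \<in> carrier G then sec x u else x"]) (auto simp: sec_one)
qed

text \<open>The dichotomy for stabilizer indices, applied to the points \<open>g ^ i\<close> and the translation by
  \<open>g\<close>.\<close>

theorem sections_of_powers_bounded_or_exponential:
  assumes g: "g \<in> carrier G"
  shows "(\<exists>b. \<forall>n. card (sec (g [^] int n) ` lists A) \<le> b) \<or>
    (\<exists>c \<beta> :: real. 0 < c \<and> 1 < \<beta> \<and> (\<forall>n. c * \<beta> ^ n \<le> card (sec (g [^] int n) ` lists A)))"
proof -
  interpret P: permutations_along_orbit section_automorphisms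
    "\<lambda>x. if x \<in> carrier G then x \<otimes> g else x" "\<lambda>i. g [^] (i :: int)"
  proof
    fix i :: int
    show "(if g [^] i \<in> carrier G then g [^] i \<otimes> g else g [^] i) = g [^] (1 + i)"
      using g int_pow_mult[of g i 1] by (simp add: add.commute)
  next
    fix i j :: int
    \<comment> \<open>Write \<open>g ^ j = g ^ (j - i) g ^ i\<close>: only a section of the first factor can change.\<close>
    have "(\<lambda>\<phi>. \<phi> (g [^] j)) ` {\<phi> \<in> section_automorphisms. \<phi> (g [^] i) = g [^] i}
        \<subseteq> (\<lambda>x. x \<otimes> g [^] i) ` sec (g [^] (j - i)) ` lists A"
    proof
      fix y assume "y \<in> (\<lambda>\<phi>. \<phi> (g [^] j)) ` {\<phi> \<in> section_automorphisms. \<phi> (g [^] i) = g [^] i}"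
      then obtain \<phi> where \<phi>: "\<phi> \<in> section_automorphisms" "\<phi> (g [^] i) = g [^] i" "y = \<phi> (g [^] j)"
        by blast
      moreover have "g [^] j = g [^] (j - i) \<otimes> g [^] i"
        using g int_pow_mult[of g "j - i" i] by simp
      ultimately show "y \<in> (\<lambda>x. x \<otimes> g [^] i) ` sec (g [^] (j - i)) ` lists A"
        using section_automorphism_at[of \<phi> "g [^] (j - i)" "g [^] i"] g by auto
    qed
    then show "finite ((\<lambda>\<phi>. \<phi> (g [^] j)) ` {\<phi> \<in> section_automorphisms. \<phi> (g [^] i) = g [^] i})"
      using finite_sections[of "g [^] (j - i)"] g finite_subset by blast
  next
    fix \<phi> assume "\<phi> \<in> section_automorphisms"
    then show "bij \<phi>" by (simp add: section_automorphisms_def)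
  qed (intro id_in_automorphisms comp_in_automorphisms inverse_in_automorphisms
      translation_in_automorphisms g; assumption)+
  have "card (P.joint_orbit {0} {i}) = card (sec (g [^] i) ` lists A)" for i
    using g stabilizer_orbit_of_one[of "g [^] i"] by (simp add: P.card_joint_orbit_singletons)
  then show ?thesis
    using P.bounded_or_exponential by simp
qed

end

section \<open>Linear lower bound for the length of powers\<close>

context self_similar_group
begin

text \<open>Take a shortest word on which \<open>x\<close> and \<open>y\<close> differ. The pairs of sections of \<open>x\<close> and \<open>y\<close> at
  its proper prefixes are distinct, since a repetition would allow cutting out the part in
  between. There are at most \<open>b * b\<close> such pairs.\<close>

lemma short_distinguishing_word:
  assumes xy: "x \<in> carrier G" "y \<in> carrier G" "x \<noteq> y"
    and bound: "card (sec x ` lists A) \<le> b" "card (sec y ` lists A) \<le> b"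
  shows "\<exists>w\<in>lists A. length w \<le> b * b \<and> act x w \<noteq> act y w"
proof -
  define D where "D = {w \<in> lists A. act x w \<noteq> act y w}"
  have "D \<noteq> {}"
    using act_faithful[of x y] xy by (auto simp: D_def)
  then obtain w where w: "w \<in> D" and min: "\<And>v. v \<in> D \<Longrightarrow> length w \<le> length v"
    using ex_has_least_nat[of "\<lambda>v. v \<in> D" _ length] by blast
  have agree: "act x v = act y v" if "v \<in> lists A" "length v < length w" for v
    using min[of v] that by (auto simp: D_def)
  have wA: "w \<in> lists A" and neq: "act x w \<noteq> act y w"
    using w by (auto simp: D_def)
  have parts: "take i w \<in> lists A" "drop i w \<in> lists A" for i
    using wA by (auto simp: in_lists_conv_set dest: in_set_takeD in_set_dropD)
  define st where "st i = (sec x (take i w), sec y (take i w))" for i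
  have "st i \<noteq> st j" if ij: "i < j" "j < length w" for i j
  proof
    assume eq: "st i = st j"
    let ?v = "take i w @ drop j w"
    have "act x ?v = act y ?v"
      using agree[of ?v] parts ij by simp
    then have "act x (take i w) @ act (sec x (take i w)) (drop j w)
        = act y (take i w) @ act (sec y (take i w)) (drop j w)"
      using act_append[OF xy(1) parts(1)[of i] parts(2)[of j]]
        act_append[OF xy(2) parts(1)[of i] parts(2)[of j]] by simp
    then have "act (sec x (take j w)) (drop j w) = act (sec y (take j w)) (drop j w)"
      using eq length_act[OF xy(1) parts(1)[of i]] length_act[OF xy(2) parts(1)[of i]]
      by (simp add: st_def)
    moreover have "act x (take j w) = act y (take j w)"
      using agree[of "take j w"] parts ij by simp
    ultimately have "act x (take j w @ drop j w) = act y (take j w @ drop j w)"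
      using act_append[OF xy(1) parts(1)[of j] parts(2)[of j]]
        act_append[OF xy(2) parts(1)[of j] parts(2)[of j]] by simp
    then show False using neq by simp
  qed
  then have "inj_on st {..<length w}"
    by (metis (no_types, lifting) inj_onI lessThan_iff linorder_neqE_nat)
  moreover have "st ` {..<length w} \<subseteq> sec x ` lists A \<times> sec y ` lists A"
    using parts by (auto simp: st_def)
  ultimately have "length w \<le> card (sec x ` lists A \<times> sec y ` lists A)"
    using card_inj_on_le[of st "{..<length w}" "sec x ` lists A \<times> sec y ` lists A"]
      finite_sections[OF xy(1)] finite_sections[OF xy(2)] by (simp del: card_cartesian_product)
  also have "\<dots> \<le> b * b"
    using bound by (simp add: card_cartesian_product mult_le_mono)
  finally show ?thesis using wA neq by blast
qed

text \<open>An element with few sections is determined by its action on the finitely many short words.\<close>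

lemma finite_bounded_sections: "finite {x \<in> carrier G. card (sec x ` lists A) \<le> b}"
proof -
  let ?W = "{w \<in> lists A. length w \<le> b * b}"
  let ?r = "\<lambda>x. restrict (act x) ?W"
  have "finite ?W"
    using finite_lists_length_le[OF finite_alphabet, of "b * b"]
    by (rule finite_subset[rotated]) (auto simp: in_lists_conv_set)
  then have "finite (PiE ?W (\<lambda>_. ?W))" by (intro finite_PiE) auto
  moreover have "?r ` {x \<in> carrier G. card (sec x ` lists A) \<le> b} \<subseteq> PiE ?W (\<lambda>_. ?W)"
    by (auto simp: act_closed length_act split: if_splits)
  moreover have "inj_on ?r {x \<in> carrier G. card (sec x ` lists A) \<le> b}"
  proof (rule inj_onI, rule ccontr)
    fix x y assume xy: "x \<in> {x \<in> carrier G. card (sec x ` lists A) \<le> b}"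
      "y \<in> {x \<in> carrier G. card (sec x ` lists A) \<le> b}" "?r x = ?r y" "x \<noteq> y"
    then obtain w where "w \<in> ?W" "act x w \<noteq> act y w"
      using short_distinguishing_word[of x y b] by auto
    then show False using fun_cong[OF xy(3), of w] by simp
  qed
  ultimately show ?thesis
    using finite_imageD finite_subset by blast
qed

text \<open>Letter by letter, by \<open>sec_mult\<close>: passing to sections does not increase the number of
  factors.\<close>

lemma sections_of_product:
  assumes "set ws \<subseteq> carrier G" "u \<in> lists A"
  shows "\<exists>ws'. length ws' = length ws \<and> set ws' \<subseteq> (\<Union>x\<in>set ws. sec x ` lists A) \<and>
    sec (foldr (\<otimes>) ws \<one>) u = foldr (\<otimes>) ws' \<one>"
  using assms
proof (induction ws arbitrary: u)
  case Nil
  then show ?case by (simp add: sec_one)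
next
  case (Cons x ws)
  let ?g = "foldr (\<otimes>) ws \<one>"
  have g: "?g \<in> carrier G" and x: "x \<in> carrier G"
    using Cons.prems by (auto simp: foldr_mult_closed)
  obtain ws' where ws': "length ws' = length ws" "set ws' \<subseteq> (\<Union>x\<in>set ws. sec x ` lists A)"
    "sec ?g u = foldr (\<otimes>) ws' \<one>"
    using Cons.IH[of u] Cons.prems by auto
  have "sec (foldr (\<otimes>) (x # ws) \<one>) u = foldr (\<otimes>) (sec x (act ?g u) # ws') \<one>"
    using sec_mult[OF x g Cons.prems(2)] ws'(3) by simp
  moreover have "sec x (act ?g u) \<in> sec x ` lists A"
    using act_closed[OF g Cons.prems(2)] by blast
  ultimately show ?case
    using ws' by (intro exI[of _ "sec x (act ?g u) # ws'"]) auto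
qed

text \<open>The sections of the generators and of their inverses form a finite set \<open>Y\<close>, and sections
  of an element of length \<open>k\<close> are products of \<open>k\<close> elements of \<open>Y\<close>. The base is at least \<open>2\<close> so
  that its logarithm is positive.\<close>

lemma card_sections_le:
  assumes S: "finite_generating_set G S"
  obtains M :: nat where "2 \<le> M"
    "\<And>x. x \<in> carrier G \<Longrightarrow> card (sec x ` lists A) \<le> M ^ word_length G S x"
proof -
  define Y where "Y = (\<Union>x\<in>S \<union> m_inv G ` S. sec x ` lists A)"
  have sub: "S \<union> m_inv G ` S \<subseteq> carrier G"
    using S by (rule letters_subset)
  have "finite Y"
    unfolding Y_def using S sub by (intro finite_UN_I finite_sections)
      (auto simp: finite_generating_set_def)
  have "card (sec x ` lists A) \<le> (card Y + 2) ^ word_length G S x" if x: "x \<in> carrier G" for x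
  proof -
    obtain ws where ws: "length ws = word_length G S x" "set ws \<subseteq> S \<union> m_inv G ` S"
      "foldr (\<otimes>) ws \<one> = x" using shortest_word[OF S x] .
    let ?L = "{ws'. set ws' \<subseteq> Y \<and> length ws' = length ws}"
    have "sec x ` lists A \<subseteq> (\<lambda>ws'. foldr (\<otimes>) ws' \<one>) ` ?L"
    proof
      fix y assume "y \<in> sec x ` lists A"
      then obtain u where u: "u \<in> lists A" "y = sec x u" by blast
      obtain ws' where "length ws' = length ws" "set ws' \<subseteq> (\<Union>x\<in>set ws. sec x ` lists A)"
        "sec (foldr (\<otimes>) ws \<one>) u = foldr (\<otimes>) ws' \<one>"
        using sections_of_product[of ws u] ws(2) sub u(1) by blast
      moreover have "(\<Union>x\<in>set ws. sec x ` lists A) \<subseteq> Y"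
        unfolding Y_def using ws(2) by blast
      ultimately show "y \<in> (\<lambda>ws'. foldr (\<otimes>) ws' \<one>) ` ?L"
        using u ws(3) by auto
    qed
    then have "card (sec x ` lists A) \<le> card ?L"
      using \<open>finite Y\<close> finite_lists_length_eq surj_card_le by blast
    also have "\<dots> = card Y ^ length ws"
      using \<open>finite Y\<close> by (rule card_lists_length_eq)
    also have "\<dots> \<le> (card Y + 2) ^ length ws"
      by (intro power_mono) auto
    finally show ?thesis using ws(1) by simp
  qed
  then show thesis using that[of "card Y + 2"] by simp
qed

text \<open>Exponentially many sections force linear length. For \<open>n > 0\<close> the length of \<open>g ^ n\<close> is at
  least \<open>1\<close>, so the additive constant that taking logarithms produces can be absorbed into the
  factor.\<close>

theorem word_length_power_linear:
  assumes S: "finite_generating_set G S" and g: "g \<in> carrier G"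
    and inf: "inj (\<lambda>i::int. g [^] i)"
  shows "\<exists>c::real. 0 < c \<and> (\<forall>n::nat. c * n \<le> word_length G S (g [^] n))"
proof -
  have "\<not> (\<forall>n. card (sec (g [^] int n) ` lists A) \<le> b)" for b
  proof
    assume "\<forall>n. card (sec (g [^] int n) ` lists A) \<le> b"
    then have "range (\<lambda>n. g [^] int n) \<subseteq> {x \<in> carrier G. card (sec x ` lists A) \<le> b}"
      using g by auto
    moreover have "inj (\<lambda>n. g [^] int n)"
      by (intro injI) (auto dest: injD[OF inf])
    ultimately show False
      using finite_bounded_sections finite_subset range_inj_infinite by blast
  qed
  then obtain c \<beta> :: real where c: "0 < c" and \<beta>: "1 < \<beta>"
    and growth: "\<And>n. c * \<beta> ^ n \<le> card (sec (g [^] int n) ` lists A)"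
    using sections_of_powers_bounded_or_exponential[OF g] by blast
  obtain M :: nat where M: "2 \<le> M"
    "\<And>x. x \<in> carrier G \<Longrightarrow> card (sec x ` lists A) \<le> M ^ word_length G S x"
    using card_sections_le[OF S] by blast
  \<comment> \<open>\<open>\<gamma>\<close> bounds the loss caused by a multiplicative constant \<open>c < 1\<close>.\<close>
  define \<gamma> where "\<gamma> = max 0 (- ln c)"
  have M0: "0 < ln (real M)" using M(1) by simp
  have bound: "n * ln \<beta> \<le> word_length G S (g [^] n) * (ln M + \<gamma>)" for n :: nat
  proof (cases "n = 0")
    case False
    let ?k = "word_length G S (g [^] n)"
    have "g [^] n \<noteq> \<one>"
      using False injD[OF inf, of "int n" 0] by (auto simp: int_pow_int)
    then have k: "1 \<le> ?k"
      using word_length_eq_0[OF S, of "g [^] n"] g by fastforce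
    have "c * \<beta> ^ n \<le> real M ^ ?k"
      using growth[of n] M(2)[of "g [^] n"] g
      by (simp add: int_pow_int, metis of_nat_le_iff of_nat_power order_trans)
    then have "ln (c * \<beta> ^ n) \<le> ln (real M ^ ?k)"
      using c \<beta> M(1) by (intro ln_mono) auto
    then have "ln c + n * ln \<beta> \<le> ?k * ln M"
      using c \<beta> M(1) by (simp add: ln_mult ln_realpow)
    then have "n * ln \<beta> \<le> ?k * ln M + \<gamma>"
      by (simp add: \<gamma>_def)
    also have "\<gamma> \<le> ?k * \<gamma>"
      using k mult_right_mono[of 1 "real ?k" \<gamma>] by (simp add: \<gamma>_def)
    finally show ?thesis by (simp add: algebra_simps)
  qed (simp add: word_length_one)
  have pos: "0 < ln M + \<gamma>" using M0 by (simp add: \<gamma>_def)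
  show ?thesis
  proof (intro exI[of _ "ln \<beta> / (ln M + \<gamma>)"] conjI allI)
    show "0 < ln \<beta> / (ln M + \<gamma>)" using \<beta> pos by simp
    show "ln \<beta> / (ln M + \<gamma>) * n \<le> word_length G S (g [^] n)" for n :: nat
      using bound[of n] pos by (simp add: field_simps)
  qed
qed

end

section \<open>Sections of words over the states of a bireversible automaton\<close>

lemma inj_on_finite_periodic:
  assumes "finite Y" "inj_on f Y" "f ` Y \<subseteq> Y" "x \<in> Y"
  shows "\<exists>m. (f ^^ Suc m) x = x"
proof -
  have closed: "(f ^^ n) x \<in> Y" for n
    using assms(3,4) by (induction n) auto
  then have "range (\<lambda>n. (f ^^ n) x) \<subseteq> Y" by blast
  then have "\<not> inj (\<lambda>n. (f ^^ n) x)"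
    using \<open>finite Y\<close> finite_subset range_inj_infinite by blast
  then obtain i j where "i \<noteq> j" "(f ^^ i) x = (f ^^ j) x"
    by (auto simp: inj_def)
  then obtain i m where "(f ^^ (i + Suc m)) x = (f ^^ i) x"
    by (metis less_natE linorder_neqE_nat add_Suc_right)
  then have "(f ^^ Suc m) x = x"
  proof (induction i)
    case (Suc i)
    then have "f ((f ^^ (i + Suc m)) x) = f ((f ^^ i) x)" by simp
    then show ?case
      using Suc.IH inj_onD[OF assms(2)] closed by blast
  qed simp
  then show ?thesis by blast
qed

text \<open>The letter \<open>x\<close>, a state or the inverse of a state, reads \<open>a\<close>: the result consists of the
  letter it writes and of its section at \<open>a\<close>. An inverse state runs the transition that writes
  \<open>a\<close> backwards: it writes the letter \<open>b\<close> read by that transition, and its section is the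
  inverse of the target.\<close>

definition signed_step :: "('a, 'q) mealy \<Rightarrow> 'q \<times> bool \<Rightarrow> 'a \<Rightarrow> 'a \<times> ('q \<times> bool)" where
  "signed_step M x a =
     (if snd x then (letter_out M (fst x, a), (next_state M (fst x, a), True))
      else let b = inv_into (alphabet M) (\<lambda>b. letter_out M (fst x, b)) a
        in (b, (next_state M (fst x, b), False)))"

text \<open>The same for a word over the states. Its last letter acts first, and what it writes is
  read by the letter before it.\<close>

fun word_step :: "('a, 'q) mealy \<Rightarrow> ('q \<times> bool) list \<Rightarrow> 'a \<Rightarrow> 'a \<times> ('q \<times> bool) list" where
  "word_step M [] a = (a, [])"
| "word_step M (x # w) a =
     (let (b, w') = word_step M w a; (c, x') = signed_step M x b in (c, x' # w'))"

definition word_section :: "('a, 'q) mealy \<Rightarrow> ('q \<times> bool) list \<Rightarrow> 'a list \<Rightarrow> ('q \<times> bool) list"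
  where "word_section M w u = foldl (\<lambda>w a. snd (word_step M w a)) w u"

locale bireversible =
  fixes M :: "('a, 'q) mealy"
  assumes bireversible: "bireversible_automaton M"
begin

abbreviation A :: "'a set" where "A \<equiv> alphabet M"
abbreviation Q :: "'q set" where "Q \<equiv> states M"
abbreviation signed_words :: "('q \<times> bool) list set" where "signed_words \<equiv> lists (Q \<times> UNIV)"

lemma mealy: "mealy_automaton M" and invertible: "invertible_automaton M"
  using bireversible by (auto simp: bireversible_automaton_def)

lemma next_state_closed: "q \<in> Q \<Longrightarrow> a \<in> A \<Longrightarrow> next_state M (q, a) \<in> Q"
  using mealy by (auto simp: mealy_automaton_def Pi_iff)

lemma letter_out_closed: "q \<in> Q \<Longrightarrow> a \<in> A \<Longrightarrow> letter_out M (q, a) \<in> A"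
  using mealy by (auto simp: mealy_automaton_def Pi_iff)

lemma letter_out_inverse:
  assumes "q \<in> Q" "a \<in> A"
  shows "inv_into A (\<lambda>b. letter_out M (q, b)) a \<in> A"
    "letter_out M (q, inv_into A (\<lambda>b. letter_out M (q, b)) a) = a"
proof -
  have "a \<in> (\<lambda>b. letter_out M (q, b)) ` A"
    using invertible assms by (simp add: invertible_automaton_def bij_betw_def)
  then show "inv_into A (\<lambda>b. letter_out M (q, b)) a \<in> A"
    "letter_out M (q, inv_into A (\<lambda>b. letter_out M (q, b)) a) = a"
    by (auto intro: inv_into_into f_inv_into_f[where f = "\<lambda>b. letter_out M (q, b)"])
qed

lemma signed_step_closed:
  assumes "x \<in> Q \<times> UNIV" "a \<in> A"
  shows "fst (signed_step M x a) \<in> A" "snd (signed_step M x a) \<in> Q \<times> UNIV"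
  using assms by (auto simp: signed_step_def Let_def next_state_closed letter_out_closed
      letter_out_inverse)

lemma state_action_bij: "q \<in> Q \<Longrightarrow> bij_betw (state_action M q) (lists A) (lists A)"
  using state_action_in_BijGroup[OF mealy invertible] by (auto simp: BijGroup_def Bij_def)

lemma inverse_letter_action:
  assumes "q \<in> Q" "u \<in> lists A"
  shows "letter_action M (q, False) u \<in> lists A"
    "state_action M q (letter_action M (q, False) u) = u"
proof -
  have "state_action M q \<in> Bij (lists A)"
    using state_action_in_BijGroup[OF mealy invertible assms(1)] by (simp add: BijGroup_def)
  then have "letter_action M (q, False) u = inv_into (lists A) (state_action M q) u"
    using assms(2) by (simp add: letter_action_def inv_BijGroup del: in_lists_conv_set)
  moreover have "u \<in> state_action M q ` lists A"
    using state_action_bij[OF assms(1)] assms(2) by (simp add: bij_betw_def)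
  ultimately show "letter_action M (q, False) u \<in> lists A"
    "state_action M q (letter_action M (q, False) u) = u"
    by (simp_all add: inv_into_into f_inv_into_f del: in_lists_conv_set)
qed

lemma inverse_letter_action_eqI:
  assumes "q \<in> Q" "v \<in> lists A" "state_action M q v = u"
  shows "letter_action M (q, False) u = v"
proof -
  have "u \<in> lists A"
    using assms state_action_bij[OF assms(1)] bij_betwE by blast
  then show ?thesis
    using inverse_letter_action[OF assms(1), of u] assms state_action_bij[OF assms(1)]
    by (metis bij_betw_def inj_onD)
qed

lemma letter_action_Cons:
  assumes "x \<in> Q \<times> UNIV" "a \<in> A" "v \<in> lists A"
  shows "letter_action M x (a # v)
    = fst (signed_step M x a) # letter_action M (snd (signed_step M x a)) v"
proof (cases "snd x")
  case True
  then show ?thesis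
    using assms by (auto simp: letter_action_def signed_step_def state_action_def)
next
  case False
  obtain q where x: "x = (q, False)" and q: "q \<in> Q"
    using False assms(1) by (cases x) auto
  let ?b = "inv_into A (\<lambda>b. letter_out M (q, b)) a"
  let ?v = "letter_action M (next_state M (q, ?b), False) v"
  note b = letter_out_inverse[OF q assms(2)]
  have v: "?v \<in> lists A" "state_action M (next_state M (q, ?b)) ?v = v"
    using inverse_letter_action[of "next_state M (q, ?b)" v] next_state_closed[OF q b(1)] assms(3)
    by blast+
  then have "state_action M q (?b # ?v) = a # v"
    using b by (simp add: state_action_def)
  then have "letter_action M (q, False) (a # v) = ?b # ?v"
    using inverse_letter_action_eqI[OF q, of "?b # ?v"] v b by simp
  then show ?thesis by (simp add: x signed_step_def Let_def)
qed

text \<open>This is where bireversibility enters. For states the claim is reversibility. For inverse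
  states let \<open>b\<close> and \<open>c\<close> be the letters that the two states turn into \<open>a\<close>; equal sections mean
  that the transitions \<open>(p, b)\<close> and \<open>(q, c)\<close> have the same output letter and the same target,
  and such a transition is unique by the third condition.\<close>

lemma signed_step_inj:
  assumes "a \<in> A"
  shows "inj_on (\<lambda>x. snd (signed_step M x a)) (Q \<times> UNIV)"
proof (rule inj_onI, clarify)
  fix p q s t assume pq: "p \<in> Q" "q \<in> Q"
    and eq: "snd (signed_step M (p, s) a) = snd (signed_step M (q, t) a)"
  then have st: "s = t" by (auto simp: signed_step_def Let_def split: if_splits)
  show "p = q \<and> s = t"
  proof (cases s)
    case True
    then have "next_state M (p, a) = next_state M (q, a)"
      using eq st by (simp add: signed_step_def)
    then show ?thesis
      using bireversible assms pq st
      by (auto simp: bireversible_automaton_def reversible_automaton_def bij_betw_def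
          dest: inj_onD)
  next
    case False
    let ?b = "inv_into A (\<lambda>b. letter_out M (p, b)) a"
    let ?c = "inv_into A (\<lambda>b. letter_out M (q, b)) a"
    have "next_state M (p, ?b) = next_state M (q, ?c)"
      using eq st False by (simp add: signed_step_def Let_def)
    then have same: "(letter_out M (p, ?b), next_state M (p, ?b))
        = (letter_out M (q, ?c), next_state M (q, ?c))"
      using letter_out_inverse pq assms by simp
    have "inj_on (\<lambda>x. (letter_out M x, next_state M x)) (Q \<times> A)"
      using bireversible by (simp add: bireversible_automaton_def bij_betw_def)
    moreover have "(p, ?b) \<in> Q \<times> A" "(q, ?c) \<in> Q \<times> A"
      using letter_out_inverse pq assms by auto
    ultimately have "(p, ?b) = (q, ?c)"
      using same inj_onD[of "\<lambda>x. (letter_out M x, next_state M x)" "Q \<times> A" "(p, ?b)" "(q, ?c)"] by simp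
    then show ?thesis using st by simp
  qed
qed

lemma free_action_Cons:
  assumes "x \<in> Q \<times> UNIV" "w \<in> signed_words" "u \<in> lists A"
  shows "free_action M (x # w) u = letter_action M x (free_action M w u)"
  using letter_action_in_BijGroup[OF mealy invertible assms(1)]
    free_action_in_BijGroup[OF mealy invertible assms(2)] assms(3)
  by (simp add: free_action_def BijGroup_def compose_eq del: in_lists_conv_set)

lemma free_action_closed:
  assumes "w \<in> signed_words" "u \<in> lists A"
  shows "free_action M w u \<in> lists A"
  using free_action_in_BijGroup[OF mealy invertible assms(1)] assms(2)
  by (auto simp: BijGroup_def Bij_def bij_betw_def)

lemma free_action_empty_word: "u \<in> lists A \<Longrightarrow> free_action M [] u = u"
  by (simp add: free_action_def BijGroup_def)

lemma word_step_properties: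
  assumes "w \<in> signed_words" "a \<in> A"
  shows "fst (word_step M w a) \<in> A" "snd (word_step M w a) \<in> signed_words"
    "length (snd (word_step M w a)) = length w"
    "v \<in> lists A \<Longrightarrow>
      free_action M w (a # v) = fst (word_step M w a) # free_action M (snd (word_step M w a)) v"
proof -
  have "fst (word_step M w a) \<in> A \<and> snd (word_step M w a) \<in> signed_words \<and>
    length (snd (word_step M w a)) = length w \<and>
    (\<forall>v\<in>lists A. free_action M w (a # v)
      = fst (word_step M w a) # free_action M (snd (word_step M w a)) v)"
    using assms(1)
  proof (induction w)
    case Nil
    show ?case using assms(2) by (simp add: free_action_empty_word)
  next
    case (Cons x w)
    obtain b w' where bw: "word_step M w a = (b, w')" by (rule prod.exhaust)
    obtain c x' where cx: "signed_step M x b = (c, x')" by (rule prod.exhaust)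
    have IH: "b \<in> A" "w' \<in> signed_words" "length w' = length w"
      "\<And>v. v \<in> lists A \<Longrightarrow> free_action M w (a # v) = b # free_action M w' v"
      using Cons.IH by (simp_all add: bw del: in_lists_conv_set)
    have c: "c \<in> A" "x' \<in> Q \<times> UNIV"
      using signed_step_closed[OF Cons.hyps(1) IH(1)] cx by auto
    have "free_action M (x # w) (a # v) = c # free_action M (x' # w') v" if v: "v \<in> lists A" for v
    proof -
      have "free_action M w' v \<in> lists A"
        using free_action_closed[OF IH(2) v] .
      then show ?thesis
        using Cons.hyps IH c v assms(2) cx letter_action_Cons[OF Cons.hyps(1) IH(1)]
        by (simp add: free_action_Cons del: in_lists_conv_set)
    qed
    then show ?case using IH c by (simp add: bw cx del: in_lists_conv_set)
  qed
  then show "fst (word_step M w a) \<in> A" "snd (word_step M w a) \<in> signed_words"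
    "length (snd (word_step M w a)) = length w"
    "v \<in> lists A \<Longrightarrow>
      free_action M w (a # v) = fst (word_step M w a) # free_action M (snd (word_step M w a)) v"
    by blast+
qed

text \<open>The section of \<open>x # w\<close> shows the section of \<open>w\<close>, hence \<open>w\<close>, hence the letter that \<open>x\<close>
  reads, and finally \<open>x\<close>. Words are compared here, and not the permutations that they define,
  because distinct states may define the same permutation.\<close>

lemma word_step_inj:
  assumes "a \<in> A"
  shows "inj_on (\<lambda>w. snd (word_step M w a)) signed_words"
proof (rule inj_onI)
  fix w w' assume "w \<in> signed_words" "w' \<in> signed_words"
    "snd (word_step M w a) = snd (word_step M w' a)"
  then show "w = w'"
  proof (induction w arbitrary: w')
    case Nil
    then have "length w' = 0"
      using word_step_properties(3)[of w' a] assms by simp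
    then show ?case by simp
  next
    case (Cons x w)
    have "length w' = Suc (length w)"
      using Cons.prems Cons.hyps word_step_properties(3)[of w' a]
        word_step_properties(3)[of "x # w" a] assms by simp
    then obtain y v where w': "w' = y # v" by (cases w') auto
    have yv: "y \<in> Q \<times> UNIV" "v \<in> signed_words" using Cons.prems w' by auto
    have "snd (word_step M w a) = snd (word_step M v a)"
      "snd (signed_step M x (fst (word_step M w a))) = snd (signed_step M y (fst (word_step M v a)))"
      using Cons.prems(2) by (auto simp: w' split: prod.splits)
    moreover from this have "w = v"
      using Cons.IH yv by blast
    ultimately show ?case
      using signed_step_inj[OF word_step_properties(1)[OF yv(2) assms]] Cons.hyps yv w'
      by (auto dest: inj_onD)
  qed
qed

lemma word_section_Nil: "word_section M w [] = w"
  and word_section_Cons: "word_section M w (a # u) = word_section M (snd (word_step M w a)) u"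
  by (simp_all add: word_section_def)

lemma word_section_closed:
  assumes "w \<in> signed_words" "u \<in> lists A"
  shows "word_section M w u \<in> signed_words \<and> length (word_section M w u) = length w"
  using assms(2,1)
proof (induction u arbitrary: w)
  case (Cons a u)
  then show ?case
    using word_step_properties(2,3)[of w a]
    by (simp add: word_section_Cons del: in_lists_conv_set)
qed (simp add: word_section_Nil)

lemma word_section_inj:
  assumes "u \<in> lists A"
  shows "inj_on (\<lambda>w. word_section M w u) signed_words"
  using assms
proof (induction u)
  case Nil
  show ?case by (simp add: word_section_Nil)
next
  case (Cons a u)
  have "inj_on ((\<lambda>w. word_section M w u) \<circ> (\<lambda>w. snd (word_step M w a))) signed_words"
    using Cons word_step_properties(2)[of _ a]
    by (intro comp_inj_on word_step_inj inj_on_subset[OF Cons.IH]) auto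
  then show ?case by (simp add: word_section_Cons o_def)
qed

text \<open>Sections preserve the length of words, and there are finitely many words of each length.\<close>

lemma word_section_periodic:
  assumes w: "w \<in> signed_words" and u: "u \<in> lists A"
  shows "\<exists>m. ((\<lambda>w. word_section M w u) ^^ Suc m) w = w"
proof (rule inj_on_finite_periodic)
  let ?Y = "{v \<in> signed_words. length v = length w}"
  have "finite Q" using mealy by (simp add: mealy_automaton_def)
  then show "finite ?Y"
    using finite_lists_length_eq[of "Q \<times> (UNIV :: bool set)" "length w"]
    by (rule_tac finite_subset[rotated]) auto
  show "inj_on (\<lambda>w. word_section M w u) ?Y"
    by (rule inj_on_subset[OF word_section_inj[OF u]]) blast
  show "(\<lambda>w. word_section M w u) ` ?Y \<subseteq> ?Y"
    by (rule image_subsetI) (simp add: word_section_closed u del: in_lists_conv_set)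
qed (use w in simp)

lemma finite_word_sections:
  assumes w: "w \<in> signed_words"
  shows "finite (word_section M w ` lists A)"
proof (rule finite_subset)
  have "finite Q" using mealy by (simp add: mealy_automaton_def)
  then show "finite {v. set v \<subseteq> Q \<times> (UNIV :: bool set) \<and> length v = length w}"
    by (intro finite_lists_length_eq) simp
  show "word_section M w ` lists A \<subseteq> {v. set v \<subseteq> Q \<times> (UNIV :: bool set) \<and> length v = length w}"
    using word_section_closed[OF w] by auto
qed

lemma free_action_Nil:
  assumes "w \<in> signed_words"
  shows "free_action M w [] = []"
  using assms
proof (induction w)
  case Nil
  show ?case by (simp add: free_action_empty_word)
next
  case (Cons x w)
  have "letter_action M x [] = []"
  proof (cases "snd x")
    case True
    then show ?thesis by (simp add: letter_action_def state_action_def)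
  next
    case False
    then show ?thesis
      using Cons.hyps(1) inverse_letter_action_eqI[of "fst x" "[]" "[]"]
      by (cases x) (auto simp: state_action_def)
  qed
  then show ?case using Cons by (simp add: free_action_Cons del: in_lists_conv_set)
qed

lemma free_action_append:
  assumes "w \<in> signed_words" "u \<in> lists A" "v \<in> lists A"
  shows "free_action M w (u @ v) = free_action M w u @ free_action M (word_section M w u) v"
  using assms(2,1)
proof (induction u arbitrary: w)
  case Nil
  then show ?case by (simp add: word_section_Nil free_action_Nil del: in_lists_conv_set)
next
  case (Cons a u)
  then show ?case
    using assms(3) word_step_properties(2,4)[of w a]
    by (simp add: word_section_Cons del: in_lists_conv_set)
qed

lemma length_free_action:
  assumes "w \<in> signed_words" "u \<in> lists A"
  shows "length (free_action M w u) = length u"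
  using assms(2,1)
proof (induction u arbitrary: w)
  case Nil
  then show ?case by (simp add: free_action_Nil del: in_lists_conv_set)
next
  case (Cons a u)
  then show ?case
    using word_step_properties(2,4)[of w a] by (simp del: in_lists_conv_set)
qed

lemma free_action_extensional: "w \<in> signed_words \<Longrightarrow> free_action M w \<in> extensional (lists A)"
  using free_action_in_BijGroup[OF mealy invertible] by (auto simp: BijGroup_def Bij_def)

text \<open>Sections of words depend only on the permutation that the word defines, because this
  permutation determines its sections; so they descend to the automaton group.\<close>

lemma word_section_cong:
  assumes w: "w \<in> signed_words" "w' \<in> signed_words" and eq: "free_action M w = free_action M w'"
    and u: "u \<in> lists A"
  shows "free_action M (word_section M w u) = free_action M (word_section M w' u)"
proof (rule extensionalityI)
  fix v assume v: "v \<in> lists A"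
  show "free_action M (word_section M w u) v = free_action M (word_section M w' u) v"
    using free_action_append[OF w(1) u v] free_action_append[OF w(2) u v] eq by simp
qed (use free_action_extensional word_section_closed w u in blast)+

text \<open>Sections of reduced words are taken letter by letter, without checking that they are
  reduced again. Working with all words is harmless, as free reduction does not change the
  action.\<close>

lemma free_action_reduced_words:
  "free_action M ` carrier (free_group Q) = free_action M ` signed_words"
proof (intro equalityI subsetI)
  fix f assume "f \<in> free_action M ` signed_words"
  then obtain w where w: "w \<in> signed_words" and f: "f = free_action M w" by blast
  have "free_action M (foldr push_letter w []) = free_action M w"
    using w
  proof (induction w)
    case (Cons x w)
    then have "foldr push_letter w [] \<in> signed_words"
      by (intro foldr_push_in_lists) auto
    then show ?case
      using Cons free_action_push[OF mealy invertible Cons.hyps(1)]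
      by (simp add: free_action_def del: in_lists_conv_set)
  qed simp
  moreover have "foldr push_letter w [] \<in> carrier (free_group Q)"
    using w foldr_push_in_lists[of w Q "[]"] freely_reduced_foldr_push[of "[]" w]
    by (simp add: free_group_def del: in_lists_conv_set)
  ultimately show "f \<in> free_action M ` carrier (free_group Q)"
    unfolding f by (metis imageI)
qed (auto simp: free_group_def)

text \<open>The first isomorphism theorem, with the image of the free group as target.\<close>

lemma automaton_group_embedding:
  obtains \<theta> where "\<theta> \<in> hom (automaton_group M) (BijGroup (lists A))"
    "inj_on \<theta> (carrier (automaton_group M))"
    "\<theta> ` carrier (automaton_group M) = free_action M ` signed_words"
proof -
  let ?B = "BijGroup (lists A)" and ?F = "free_group Q"
  let ?I = "?B\<lparr>carrier := free_action M ` carrier ?F\<rparr>"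
  interpret f: group_hom ?F ?B "free_action M"
    by (rule free_action_hom[OF mealy invertible])
  have sub: "subgroup (free_action M ` carrier ?F) ?B"
    by (rule f.img_is_subgroup)
  have "free_action M \<in> hom ?F ?I"
    using f.homh by (auto simp: hom_def)
  then interpret i: group_hom ?F ?I "free_action M"
    using subgroup.subgroup_is_group[OF sub f.H.is_group]
    by (intro group_hom.intro group_hom_axioms.intro f.G.is_group)
  have "kernel ?F ?I (free_action M) = kernel ?F ?B (free_action M)"
    by (simp add: kernel_def)
  then have iso: "(\<lambda>Y. the_elem (free_action M ` Y)) \<in> iso (automaton_group M) ?I"
    using i.FactGroup_iso_set by (simp add: automaton_group_def)
  show thesis
  proof (rule that)
    show "(\<lambda>Y. the_elem (free_action M ` Y)) \<in> hom (automaton_group M) ?B"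
      using iso subgroup.subset[OF sub] by (fastforce simp: iso_def hom_def)
    show "inj_on (\<lambda>Y. the_elem (free_action M ` Y)) (carrier (automaton_group M))"
      using iso by (simp add: iso_def bij_betw_def)
    show "(\<lambda>Y. the_elem (free_action M ` Y)) ` carrier (automaton_group M)
        = free_action M ` signed_words"
      using iso by (simp add: iso_def bij_betw_def free_action_reduced_words)
  qed
qed

end

section \<open>Bireversible groups as self-similar groups\<close>

lemma BijGroup_mult_apply:
  assumes "f \<in> carrier (BijGroup Y)" "g \<in> carrier (BijGroup Y)" "y \<in> Y"
  shows "(f \<otimes>\<^bsub>BijGroup Y\<^esub> g) y = f (g y)"
  using assms by (simp add: BijGroup_def compose_eq)

context bireversible
begin

text \<open>Sections are transported from words to \<open>G\<close> along the embedding \<open>\<theta>\<close>: choose a word for \<open>g\<close>,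
  take its section and return to \<open>G\<close>. Periodicity and finiteness are inherited from words.\<close>

lemma self_similar_structure:
  assumes G: "group G" and \<theta>: "\<theta> \<in> hom G (BijGroup (lists A))" "inj_on \<theta> (carrier G)"
    and img: "\<theta> ` carrier G = free_action M ` signed_words"
  shows "\<exists>sec. self_similar_group G A \<theta> sec"
proof -
  define word where "word g = (SOME w. w \<in> signed_words \<and> \<theta> g = free_action M w)" for g
  define sec where
    "sec g u = inv_into (carrier G) \<theta> (free_action M (word_section M (word g) u))" for g u
  interpret \<theta>: group_hom G "BijGroup (lists A)" \<theta>
    using G \<theta>(1) by (simp add: group_hom_def group_hom_axioms_def group_BijGroup)
  have word: "word g \<in> signed_words" "\<theta> g = free_action M (word g)" if "g \<in> carrier G" for g
  proof -
    have "\<exists>w. w \<in> signed_words \<and> \<theta> g = free_action M w"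
      using img that by blast
    then have "word g \<in> signed_words \<and> \<theta> g = free_action M (word g)"
      unfolding word_def by (rule someI_ex)
    then show "word g \<in> signed_words" "\<theta> g = free_action M (word g)" by blast+
  qed
  have sec: "sec g u \<in> carrier G" "\<theta> (sec g u) = free_action M (word_section M (word g) u)"
    if "g \<in> carrier G" "u \<in> lists A" for g u
  proof -
    have "free_action M (word_section M (word g) u) \<in> \<theta> ` carrier G"
      unfolding img using word_section_closed[OF word(1)[OF that(1)] that(2)] by blast
    then show "sec g u \<in> carrier G" "\<theta> (sec g u) = free_action M (word_section M (word g) u)"
      unfolding sec_def by (rule inv_into_into, rule f_inv_into_f)
  qed
  have sec_word: "\<theta> (sec g u) = free_action M (word_section M w u)"
    if "g \<in> carrier G" "u \<in> lists A" "w \<in> signed_words" "\<theta> g = free_action M w" for g u w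
    using sec[OF that(1,2)] word[OF that(1)] word_section_cong[of "word g" w u] that by metis
  have "self_similar_group G A \<theta> sec"
  proof (intro self_similar_group.intro self_similar_group_axioms.intro G)
    show "finite A" using mealy by (simp add: mealy_automaton_def)
    fix g u assume g: "g \<in> carrier G" and u: "u \<in> lists A"
    show "\<theta> g u \<in> lists A"
      using free_action_closed[OF word(1)[OF g] u] word(2)[OF g] by simp
    show "length (\<theta> g u) = length u"
      using length_free_action[OF word(1)[OF g] u] word(2)[OF g] by simp
    show "sec g u \<in> carrier G" by (rule sec(1)[OF g u])
    show "\<theta> g (u @ v) = \<theta> g u @ \<theta> (sec g u) v" if "v \<in> lists A" for v
      using free_action_append[OF word(1)[OF g] u that] word(2)[OF g] sec(2)[OF g u] by simp
    show "\<exists>m. ((\<lambda>h. sec h u) ^^ Suc m) g = g"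
    proof -
      obtain m where m: "((\<lambda>w. word_section M w u) ^^ Suc m) (word g) = word g"
        using word_section_periodic[OF word(1)[OF g] u] by blast
      \<comment> \<open>Iterated sections in \<open>G\<close> are represented by iterated sections of the chosen word,
        though not necessarily by the words chosen for them.\<close>
      have "((\<lambda>h. sec h u) ^^ n) g \<in> carrier G \<and>
          ((\<lambda>w. word_section M w u) ^^ n) (word g) \<in> signed_words \<and>
          \<theta> (((\<lambda>h. sec h u) ^^ n) g) = free_action M (((\<lambda>w. word_section M w u) ^^ n) (word g))"
        for n
      proof (induction n)
        case 0
        show ?case using g word[OF g] by simp
      next
        case (Suc n)
        then show ?case
          using sec(1)[OF _ u] sec_word[OF _ u] word_section_closed[OF _ u]
          by (simp del: in_lists_conv_set)
      qed
      from this[of "Suc m"] have "((\<lambda>h. sec h u) ^^ Suc m) g \<in> carrier G"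
        "\<theta> (((\<lambda>h. sec h u) ^^ Suc m) g) = \<theta> g"
        unfolding m using word(2)[OF g] by simp_all
      then show ?thesis using inj_onD[OF \<theta>(2)] g by blast
    qed
  next
    fix u assume "u \<in> lists A"
    then show "\<theta> \<one>\<^bsub>G\<^esub> u = u"
      using \<theta>.hom_one by (simp add: BijGroup_def del: in_lists_conv_set)
  next
    fix g h u assume "g \<in> carrier G" "h \<in> carrier G" "u \<in> lists A"
    then show "\<theta> (g \<otimes>\<^bsub>G\<^esub> h) u = \<theta> g (\<theta> h u)"
      by (simp add: BijGroup_mult_apply del: in_lists_conv_set)
  next
    fix g h assume gh: "g \<in> carrier G" "h \<in> carrier G"
      and eq: "\<And>u. u \<in> lists A \<Longrightarrow> \<theta> g u = \<theta> h u"
    have "\<theta> g \<in> extensional (lists A)" "\<theta> h \<in> extensional (lists A)"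
      using word[OF gh(1)] word[OF gh(2)] free_action_extensional by simp_all
    then have "\<theta> g = \<theta> h" using eq by (rule extensionalityI)
    then show "g = h" using inj_onD[OF \<theta>(2)] gh by blast
  next
    fix g assume g: "g \<in> carrier G"
    have "\<theta> ` sec g ` lists A \<subseteq> free_action M ` word_section M (word g) ` lists A"
      using sec(2)[OF g] by blast
    then have "finite (\<theta> ` sec g ` lists A)"
      using finite_word_sections[OF word(1)[OF g]] finite_subset by blast
    moreover have "inj_on \<theta> (sec g ` lists A)"
      using sec(1)[OF g] by (intro inj_on_subset[OF \<theta>(2)]) blast
    ultimately show "finite (sec g ` lists A)" by (rule finite_imageD)
  qed
  then show ?thesis by blast
qed

lemma finitely_generated:
  assumes G: "group G" and \<theta>: "\<theta> \<in> hom G (BijGroup (lists A))" "inj_on \<theta> (carrier G)"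
    and img: "\<theta> ` carrier G = free_action M ` signed_words"
  shows "\<exists>S. finite_generating_set G S"
proof -
  interpret \<theta>: group_hom G "BijGroup (lists A)" \<theta>
    using G \<theta>(1) by (simp add: group_hom_def group_hom_axioms_def group_BijGroup)
  define S where "S = {s \<in> carrier G. \<theta> s \<in> state_action M ` Q}"
  have "finite Q" using mealy by (simp add: mealy_automaton_def)
  have "\<theta> ` S \<subseteq> state_action M ` Q" by (auto simp: S_def)
  then have "finite (\<theta> ` S)" using \<open>finite Q\<close> finite_subset by blast
  moreover have "inj_on \<theta> S"
    by (rule inj_on_subset[OF \<theta>(2)]) (auto simp: S_def)
  ultimately have "finite S" by (rule finite_imageD)
  have SG: "S \<subseteq> carrier G" by (auto simp: S_def)
  have gen: "generate G S \<subseteq> carrier G"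
    using \<theta>.G.generate_incl SG by blast
  have letter: "\<exists>g\<in>generate G S. \<theta> g = letter_action M x" if x: "x \<in> Q \<times> UNIV" for x
  proof -
    have q: "fst x \<in> Q" using x by auto
    have "free_action M [(fst x, True)] = state_action M (fst x)"
      using state_action_in_BijGroup[OF mealy invertible q]
        group.is_monoid[OF group_BijGroup[of "lists A"]]
      by (simp add: free_action_def letter_action_def monoid.r_one)
    then have "state_action M (fst x) \<in> \<theta> ` carrier G"
      unfolding img using q by (intro image_eqI[of _ _ "[(fst x, True)]"]) auto
    then obtain s where s: "s \<in> carrier G" "\<theta> s = state_action M (fst x)" by force
    then have "s \<in> S" using q by (auto simp: S_def)
    then have "s \<in> generate G S" "inv\<^bsub>G\<^esub> s \<in> generate G S"
      by (auto intro: generate.incl generate.inv)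
    moreover have "\<theta> (inv\<^bsub>G\<^esub> s) = inv\<^bsub>BijGroup (lists A)\<^esub> state_action M (fst x)"
      using s by simp
    ultimately show ?thesis
      using s(2) unfolding letter_action_def by (cases "snd x") (simp, blast)+
  qed
  have "\<exists>g\<in>generate G S. \<theta> g = free_action M w" if "w \<in> signed_words" for w
    using that
  proof (induction w)
    case Nil
    show ?case by (rule bexI[OF _ generate.one]) (simp add: free_action_def)
  next
    case (Cons x w)
    obtain g where g: "g \<in> generate G S" "\<theta> g = letter_action M x"
      using letter[OF Cons.hyps(1)] by blast
    obtain h where h: "h \<in> generate G S" "\<theta> h = free_action M w"
      using Cons by blast
    have "\<theta> (g \<otimes>\<^bsub>G\<^esub> h) = free_action M (x # w)"
      using g h gen by (simp add: subset_iff free_action_def)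
    then show ?case using generate.eng[OF g(1) h(1)] by blast
  qed
  note words = this
  have "carrier G \<subseteq> generate G S"
  proof
    fix g assume g: "g \<in> carrier G"
    then have "\<theta> g \<in> free_action M ` signed_words" unfolding img[symmetric] by blast
    then obtain w where "w \<in> signed_words" "\<theta> g = free_action M w" by blast
    then obtain h where h: "h \<in> generate G S" "\<theta> h = \<theta> g"
      using words[of w] by metis
    then have "h = g" using inj_onD[OF \<theta>(2)] g gen by blast
    then show "g \<in> generate G S" using h(1) by simp
  qed
  then show ?thesis
    using gen SG \<open>finite S\<close> unfolding finite_generating_set_def by blast
qed

end

text \<open>For a generator \<open>g\<close> of infinite order, the length of \<open>g ^ n\<close> in the cyclic group is at
  most \<open>n\<close> times that of \<open>g\<close>, and in the ambient group it is at least linear in \<open>n\<close>. A finite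
  subgroup is undistorted because only the identity has length \<open>0\<close>.\<close>

lemma (in group) cyclic_subgroup_undistortedI:
  assumes fg: "\<exists>S. finite_generating_set G S"
    and H: "subgroup H G" "cyclic_group (G\<lparr>carrier := H\<rparr>)"
    and linear: "\<And>S g. \<lbrakk>finite_generating_set G S; g \<in> carrier G; inj (\<lambda>i::int. g [^] i)\<rbrakk>
      \<Longrightarrow> \<exists>c::real. 0 < c \<and> (\<forall>n::nat. c * n \<le> word_length G S (g [^] n))"
  shows "undistorted G H"
proof -
  let ?H = "G\<lparr>carrier := H\<rparr>"
  interpret H: group ?H
    using subgroup.subgroup_is_group[OF H(1) is_group] .
  have sub: "H \<subseteq> carrier G" using H(1) by (rule subgroup.subset)
  have pow: "x [^]\<^bsub>?H\<^esub> i = x [^] i" if "x \<in> H" for x and i :: int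
    using int_pow_consistent[OF H(1) that] by simp
  obtain g where g: "g \<in> H" and range: "H = range (\<lambda>i::int. g [^] i)"
    using H(2) pow unfolding H.cyclic_group by auto
  have gG: "g \<in> carrier G" using g sub by blast
  have "finite_generating_set ?H {g}"
    using H.generate_pow[of g] g pow range by (auto simp: finite_generating_set_def)
  moreover have "\<exists>C::real. C > 0 \<and>
      (\<forall>h\<in>H. real (word_length ?H T h) \<le> C * real (word_length G S h))"
    if S: "finite_generating_set G S" and T: "finite_generating_set ?H T" for S T
  proof (cases "inj (\<lambda>i::int. g [^] i)")
    case True
    obtain c :: real where c: "0 < c"
      "\<And>n. c * real n \<le> real (word_length G S (g [^] n))"
      using linear[OF S gG True] by blast
    define k where "k = word_length ?H T g + 1"
    have "word_length ?H T h \<le> k / c * word_length G S h" if hH: "h \<in> H" for h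
    proof -
      obtain i :: int where h: "h = g [^] i" using hH range by blast
      have "\<exists>n::nat. h = g [^] n \<or> h = inv (g [^] n)"
        by (cases i rule: int_cases2) (auto simp: h int_pow_int int_pow_neg_int gG)
      then obtain n :: nat where hn: "h = g [^] n \<or> h = inv (g [^] n)" by blast
      have gn: "g [^] n \<in> H" using range by (metis int_pow_int rangeI)
      have "word_length ?H T (g [^] n) \<le> n * k"
        using H.word_length_pow[OF T, of g n] g by (simp add: k_def nat_pow_def algebra_simps)
      moreover have "word_length ?H T h = word_length ?H T (g [^] n)"
        using hn H.word_length_inv[OF T, of "g [^] n"] gn m_inv_consistent[OF H(1) gn] by auto
      moreover have "word_length G S h = word_length G S (g [^] n)"
        using hn word_length_inv[OF S, of "g [^] n"] gG by auto
      moreover have "real (n * k) \<le> k / c * word_length G S (g [^] n)"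
        using c(1) c(2)[of n] mult_right_mono[OF c(2)[of n], of "k / c"]
        by (simp add: mult.commute)
      ultimately show ?thesis by (metis of_nat_le_iff order_trans)
    qed
    then show ?thesis using c(1) by (intro exI[of _ "k / c"]) (auto simp: k_def)
  next
    case False
    then have "finite H"
    proof -
      have "ord g \<noteq> 0"
        using False int_pow_eq[OF gG] by (auto simp: inj_def)
      then have "H \<subseteq> (\<lambda>i::int. g [^] i) ` {0..<int (ord g)}"
      proof (intro subsetI)
        fix h assume "h \<in> H"
        then obtain i :: int where "h = g [^] i" using range by blast
        then have "h = g [^] (i mod int (ord g))"
          using int_pow_eq[OF gG, of i "i mod int (ord g)"]
          by (simp add: mod_eq_dvd_iff[symmetric] dvd_diff_commute)
        then show "h \<in> (\<lambda>i::int. g [^] i) ` {0..<int (ord g)}"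
          using \<open>ord g \<noteq> 0\<close> by auto
      qed
      then show ?thesis using finite_subset by blast
    qed
    let ?C = "Max (word_length ?H T ` H) + 1"
    have "real (word_length ?H T h) \<le> ?C * real (word_length G S h)" if h: "h \<in> H" for h
    proof (cases "h = \<one>")
      case True
      then show ?thesis using H.word_length_one[of T] by simp
    next
      case False
      then have "1 \<le> word_length G S h"
        using word_length_eq_0[OF S, of h] h sub by (metis One_nat_def Suc_leI gr0I subsetD)
      moreover have "word_length ?H T h \<le> ?C"
        using \<open>finite H\<close> h by (simp add: le_SucI)
      ultimately have "word_length ?H T h \<le> ?C * word_length G S h"
        by (metis mult.right_neutral mult_le_mono)
      then show ?thesis by (metis of_nat_le_iff of_nat_mult)
    qed
    then show ?thesis by (intro exI[of _ "real ?C"]) auto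
  qed
  ultimately show ?thesis
    unfolding undistorted_def using fg by blast
qed

section \<open>Cyclic subgroups of bireversible groups\<close>

theorem theoremD:
  fixes G :: "('g, 'm) monoid_scheme" and H :: "'g set"
  assumes "bireversible_group TYPE('a) TYPE('q) G"
    and "subgroup H G"
    and "cyclic_group (G\<lparr>carrier := H\<rparr>)"
  shows "undistorted G H"
proof -
  obtain M :: "('a, 'q) mealy" and \<phi> where G: "group G" and M: "bireversible_automaton M"
    and \<phi>: "\<phi> \<in> iso G (automaton_group M)"
    using assms(1) unfolding bireversible_group_def is_iso_def by blast
  interpret G: group G by (rule G)
  interpret bireversible M by unfold_locales (rule M)
  obtain \<theta> where \<theta>: "\<theta> \<in> hom (automaton_group M) (BijGroup (lists A))"
    "inj_on \<theta> (carrier (automaton_group M))"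
    "\<theta> ` carrier (automaton_group M) = free_action M ` signed_words"
    using automaton_group_embedding .
  have "\<phi> \<in> hom G (automaton_group M)" "inj_on \<phi> (carrier G)"
    "\<phi> ` carrier G = carrier (automaton_group M)"
    using \<phi> by (auto simp: iso_def bij_betw_def)
  note \<phi> = this
  have embedding: "\<theta> \<circ> \<phi> \<in> hom G (BijGroup (lists A))" "inj_on (\<theta> \<circ> \<phi>) (carrier G)"
    "(\<theta> \<circ> \<phi>) ` carrier G = free_action M ` signed_words"
  proof -
    show "\<theta> \<circ> \<phi> \<in> hom G (BijGroup (lists A))"
      using \<phi>(1) \<theta>(1) by (rule hom_compose)
    show "inj_on (\<theta> \<circ> \<phi>) (carrier G)"
      using \<phi>(2,3) \<theta>(2) by (simp add: comp_inj_on)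
    show "(\<theta> \<circ> \<phi>) ` carrier G = free_action M ` signed_words"
      unfolding \<theta>(3)[symmetric] \<phi>(3)[symmetric] by (rule image_comp[symmetric])
  qed
  obtain sec where "self_similar_group G A (\<theta> \<circ> \<phi>) sec"
    using self_similar_structure[OF G embedding] by blast
  then interpret self_similar_group G A "\<theta> \<circ> \<phi>" sec .
  show ?thesis
    using finitely_generated[OF G embedding] assms(2,3) word_length_power_linear
    by (rule G.cyclic_subgroup_undistortedI)
qed

end
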